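(* Let $\mathcal{X}\subset\mathbb{R}^d$ be the equilateral unit pyramid, on each of whose $(d-1)$-dimensional faces $N=d$ different constant vector fields are fixed, and consider the corresponding switched server system with an arbitrary deterministic rule for choosing, at each collision with the boundary, one of the $N$ vector fields. Assume that the standing assumption holds: for each vertex of $\mathcal{X}$ the straight lines drawn at this vertex parallel to each of the vector fields corresponding to the opposite $(d-1)$-dimensional face intersect that face at inner points. Then any trajectory of this system converges exponentially fast to some stable periodic orbit. The number of such stable periodic orbits does not exceed $(d+1)^d$.
   Context: The equilateral unit pyramid is the regular $d$-simplex. The system: a particle moves with unit velocity inside $\mathcal{X}$; at the moment of each collision with the boundary $\partial\mathcal{X}$ it changes its velocity to one of the $N=d$ vectors defined at the point of collision. Deterministic setting: the choice of the vector field is governed by a deterministic rule (for example: the vector fields are enumerated, and after each collision the number of the chosen field is increased by one modulo $N$). Such a system is represented as a skew product $(k,x)\mapsto(F(k),G(k,x))$, where the map $F$ on integers determines which vector field (server) is used next and $G(k,\cdot)$ sends a boundary point to the next intersection with $\partial\mathcal{X}$ of the trajectory leaving it along the $k$-th vector field. Correspondence of vector fields and faces in the standing assumption: the $d$ vector fields given on a face correspond to the $d$ remaining (opposite) faces, one field to each, and the line in the standing assumption for a field corresponding to a face $\Phi$ is drawn from the vertex opposite to $\Phi$, parallel to that field. The model case in which the standing assumption holds is when, on each face, the $d$ vector fields are orthogonal to the $d$ remaining faces.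
   Formalization: "Any trajectory" is restricted to motions lasting for all time, i.e. collision times do not accumulate; the claim fails otherwise, since a rule alternating between two faces drives the particle into their intersection in finite time, where no periodic orbit exists. *)

theory Defs
  imports "HOL-Analysis.Analysis"
begin

text \<open>
  The pyramid is \<open>convex hull V\<close> for its vertex set \<open>V\<close>. Its facets are indexed by the opposite
  vertices: \<open>face V p\<close> is the facet not containing \<open>p\<close>. The vector fields on a facet are numbered
  \<open>0, ..., d - 1\<close>, where \<open>d\<close> is \<open>DIM('a)\<close>, and \<open>v p k\<close> is the \<open>k\<close>-th field on \<open>face V p\<close>.
\<close>

definition equilateral_unit_pyramid :: "'a::euclidean_space set \<Rightarrow> bool" where
  "equilateral_unit_pyramid V \<longleftrightarrow>
     finite V \<and> card V = DIM('a) + 1 \<and> (\<forall>p\<in>V. \<forall>q\<in>V. p \<noteq> q \<longrightarrow> dist p q = 1)"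

definition face :: "'a::euclidean_space set \<Rightarrow> 'a \<Rightarrow> 'a set" where
  "face V p = convex hull (V - {p})"

text \<open>The particle leaves a facet into the pyramid, so every field has to point inwards.\<close>

definition server_fields :: "'a::euclidean_space set \<Rightarrow> ('a \<Rightarrow> nat \<Rightarrow> 'a) \<Rightarrow> bool" where
  "server_fields V v \<longleftrightarrow>
     (\<forall>p\<in>V. inj_on (v p) {..<DIM('a)} \<and>
        (\<forall>k<DIM('a). norm (v p k) = 1 \<and>
           (\<forall>x\<in>rel_interior (face V p). \<exists>e>0. x + e *\<^sub>R v p k \<in> interior (convex hull V))))"

text \<open>
  \<open>opp p k\<close> is the vertex opposite to the facet to which the \<open>k\<close>-th field on \<open>face V p\<close> corresponds.
\<close>

definition field_correspondence :: "'a::euclidean_space set \<Rightarrow> ('a \<Rightarrow> nat \<Rightarrow> 'a) \<Rightarrow> bool" where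
  "field_correspondence V opp \<longleftrightarrow> (\<forall>p\<in>V. bij_betw (opp p) {..<DIM('a)} (V - {p}))"

definition standing_assumption ::
    "'a::euclidean_space set \<Rightarrow> ('a \<Rightarrow> nat \<Rightarrow> 'a) \<Rightarrow> ('a \<Rightarrow> nat \<Rightarrow> 'a) \<Rightarrow> bool" where
  "standing_assumption V v opp \<longleftrightarrow>
     (\<forall>q\<in>V. \<forall>p\<in>V - {q}. \<forall>k<DIM('a). opp p k = q \<longrightarrow>
        (\<exists>s. q + s *\<^sub>R v p k \<in> rel_interior (face V q)))"

text \<open>The ray leaving \<open>x\<close> in direction \<open>u\<close> runs inside \<open>X\<close> and next meets the boundary at \<open>y\<close>.\<close>

definition next_collision :: "'a::euclidean_space set \<Rightarrow> 'a \<Rightarrow> 'a \<Rightarrow> 'a \<Rightarrow> bool" where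
  "next_collision X u x y \<longleftrightarrow>
     (\<exists>t>0. (\<forall>s\<in>{0<..<t}. x + s *\<^sub>R u \<in> interior X) \<and> x + t *\<^sub>R u \<in> frontier X \<and> y = x + t *\<^sub>R u)"

text \<open>
  The graph of the skew product \<open>(k, x) \<mapsto> (F k, G (k, x))\<close> on pairs of a field number and a
  collision point. A point in the relative interior of a facet lies on no other facet, so there the
  step is single-valued. A point common to several facets may use the fields of any of them; under
  the standing assumption only the initial point of an orbit can be of this kind.
\<close>

definition server_step ::
    "'a::euclidean_space set \<Rightarrow> ('a \<Rightarrow> nat \<Rightarrow> 'a) \<Rightarrow> (nat \<Rightarrow> nat) \<Rightarrow> nat \<times> 'a \<Rightarrow> nat \<times> 'a \<Rightarrow> bool" where
  "server_step V v F = (\<lambda>(k, x) (k', y).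
     k < DIM('a) \<and> k' = F k \<and>
     (\<exists>p\<in>V. x \<in> face V p \<and> next_collision (convex hull V) (v p k) x y))"

definition server_orbit ::
    "'a::euclidean_space set \<Rightarrow> ('a \<Rightarrow> nat \<Rightarrow> 'a) \<Rightarrow> (nat \<Rightarrow> nat) \<Rightarrow> (nat \<Rightarrow> nat \<times> 'a) \<Rightarrow> bool" where
  "server_orbit V v F z \<longleftrightarrow> (\<forall>n. server_step V v F (z n) (z (Suc n)))"

text \<open>The speed is one, so the time of the \<open>n\<close>-th collision is the length of the path up to it.\<close>

definition collision_time :: "(nat \<Rightarrow> nat \<times> 'a::euclidean_space) \<Rightarrow> nat \<Rightarrow> real" where
  "collision_time z n = (\<Sum>i<n. dist (snd (z i)) (snd (z (Suc i))))"

text \<open>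
  A trajectory is a motion of the particle with unit speed during the whole time interval
  \<open>[0, \<infinity>)\<close>. If the collision times accumulated, the motion would be defined only up to a finite
  time, at which the particle runs into an intersection of facets. Such motions do occur: a rule that
  alternates between two facets drives the particle into their intersection, which for \<open>d \<ge> 3\<close>
  contains a continuum of possible limit points.
\<close>

definition server_trajectory ::
    "'a::euclidean_space set \<Rightarrow> ('a \<Rightarrow> nat \<Rightarrow> 'a) \<Rightarrow> (nat \<Rightarrow> nat) \<Rightarrow> (nat \<Rightarrow> nat \<times> 'a) \<Rightarrow> bool" where
  "server_trajectory V v F z \<longleftrightarrow>
     server_orbit V v F z \<and> filterlim (collision_time z) at_top sequentially"

definition stable_orbit ::
    "'a::euclidean_space set \<Rightarrow> ('a \<Rightarrow> nat \<Rightarrow> 'a) \<Rightarrow> (nat \<Rightarrow> nat) \<Rightarrow> (nat \<Rightarrow> nat \<times> 'a) \<Rightarrow> bool" where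
  "stable_orbit V v F z \<longleftrightarrow>
     (\<forall>e>0. \<exists>r>0. \<forall>w. server_orbit V v F w \<and> dist (w 0) (z 0) < r \<longrightarrow>
        (\<forall>n. dist (w n) (z n) < e)) \<and>
     (\<exists>r>0. \<forall>w. server_orbit V v F w \<and> dist (w 0) (z 0) < r \<longrightarrow>
        (\<lambda>n. dist (w n) (z n)) \<longlonglongrightarrow> 0)"

definition stable_periodic_trajectory ::
    "'a::euclidean_space set \<Rightarrow> ('a \<Rightarrow> nat \<Rightarrow> 'a) \<Rightarrow> (nat \<Rightarrow> nat) \<Rightarrow> (nat \<Rightarrow> nat \<times> 'a) \<Rightarrow> bool" where
  "stable_periodic_trajectory V v F z \<longleftrightarrow>
     server_trajectory V v F z \<and> (\<exists>m>0. \<forall>n. z (n + m) = z n) \<and> stable_orbit V v F z"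

text \<open>
  The distance is that of \<open>nat \<times> 'a\<close>, so the field numbers are required to agree eventually.
\<close>

definition converges_exponentially ::
    "(nat \<Rightarrow> nat \<times> 'a::euclidean_space) \<Rightarrow> (nat \<Rightarrow> nat \<times> 'a) \<Rightarrow> bool" where
  "converges_exponentially z w \<longleftrightarrow>
     (\<exists>C q. 0 < q \<and> q < 1 \<and> (\<forall>n. dist (z n) (w n) \<le> C * q ^ n))"

text \<open>
  A periodic orbit is the set of states of a periodic trajectory, so that trajectories differing
  only by their starting point on the orbit are counted once.
\<close>

definition stable_periodic_orbits ::
    "'a::euclidean_space set \<Rightarrow> ('a \<Rightarrow> nat \<Rightarrow> 'a) \<Rightarrow> (nat \<Rightarrow> nat) \<Rightarrow> (nat \<times> 'a) set set" where
  "stable_periodic_orbits V v F = {range z | z. stable_periodic_trajectory V v F z}"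

end

theory Submission
  imports Defs
begin

text \<open>
  In barycentric coordinates a flight from the facet opposite to \<open>p\<close> to the facet opposite to \<open>q\<close>
  removes the mass at \<open>q\<close> and distributes it, with strictly positive fixed proportions, among all
  the other vertices; this is what the standing assumption says. So the next facet depends only on
  the current facet and field number, and these symbols, having finitely many values, are eventually
  periodic. Two orbits with the same symbols differ by a vector of total mass zero to which the same
  column-stochastic matrices are applied. Since the time is infinite, every facet is hit infinitely
  often; once the symbols are periodic, a whole period of redistributions spreads the mass over all
  vertices except the one emptied last, hence contracts the \<open>l\<^sup>1\<close> norm by a fixed factor. The
  translates of an orbit by multiples of the period therefore converge to a periodic orbit, which is
  stable and determined by any of its symbols.
\<close>

section \<open>Redistribution of mass\<close>

text \<open>Step \<open>n\<close> empties \<open>p (Suc n)\<close>; the vertex \<open>p n\<close> has been emptied by the step before.\<close>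

locale redistribution =
  fixes V :: "'v set" and p :: "nat \<Rightarrow> 'v" and c :: "nat \<Rightarrow> 'v \<Rightarrow> real" and \<epsilon> :: real
  assumes finite_V: "finite V"
    and p_in: "p n \<in> V"
    and p_Suc_neq: "p (Suc n) \<noteq> p n"
    and c_removed: "c n (p (Suc n)) = - 1"
    and c_lower: "r \<in> V \<Longrightarrow> r \<noteq> p (Suc n) \<Longrightarrow> \<epsilon> \<le> c n r"
    and sum_c: "sum (c n) V = 0"
    and eps_pos: "0 < \<epsilon>"
begin

text \<open>The non-autonomous linear recursion started at time \<open>m\<close>, with its own index
  beginning at 0. Signs of \<open>y\<close> are left free, so that differences of mass distributions
  are covered too.\<close>

definition evolves :: "nat \<Rightarrow> (nat \<Rightarrow> 'v \<Rightarrow> real) \<Rightarrow> bool" where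
  "evolves m y \<longleftrightarrow> (\<forall>n r. y (Suc n) r = y n r + y n (p (Suc (m + n))) * c (m + n) r)"

lemma evolvesD: "evolves m y \<Longrightarrow> y (Suc n) r = y n r + y n (p (Suc (m + n))) * c (m + n) r"
  by (simp add: evolves_def)

lemma evolves_diff:
  assumes "evolves m y" "evolves m y'"
  shows "evolves m (\<lambda>n r. y n r - y' n r)"
  using assms by (simp add: evolves_def algebra_simps)

lemma evolves_shift: "evolves m y \<Longrightarrow> evolves (m + i) (\<lambda>n. y (i + n))"
  by (simp add: evolves_def add.assoc)

lemma evolves_exists: "\<exists>y. evolves m y \<and> y 0 = y0"
proof -
  define y where "y = rec_nat y0 (\<lambda>n f r. f r + f (p (Suc (m + n))) * c (m + n) r)"
  show ?thesis by (rule exI[of _ y]) (simp add: evolves_def y_def)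
qed

lemma evolves_unique:
  assumes "evolves m y" "evolves m y'" "y 0 = y' 0"
  shows "y n = y' n"
proof (induction n)
  case (Suc n)
  then show ?case by (intro ext) (simp add: evolvesD[OF assms(1)] evolvesD[OF assms(2)])
qed (use assms in simp)

lemma sum_c_others: "sum (c n) (V - {p (Suc n)}) = 1"
  using sum_c[of n] c_removed[of n] sum.remove[OF finite_V p_in, of "c n" "Suc n"] by simp

text \<open>The vertex \<open>p 0\<close> is not emptied at step 0, and its share is one of several
  nonnegative shares with sum 1.\<close>

lemma eps_le_1: "\<epsilon> \<le> 1"
proof -
  have "\<epsilon> \<le> c 0 (p 0)" using p_in p_Suc_neq by (metis c_lower)
  also have "\<dots> \<le> sum (c 0) (V - {p (Suc 0)})"
    using p_in p_Suc_neq[of 0] eps_pos finite_V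
    by (intro member_le_sum) (auto intro: order_trans[OF _ c_lower])
  finally show ?thesis by (simp add: sum_c_others)
qed

lemma evolves_sum:
  assumes "evolves m y"
  shows "sum (y n) V = sum (y 0) V"
proof (induction n)
  case (Suc n)
  have "sum (y (Suc n)) V = sum (y n) V + y n (p (Suc (m + n))) * sum (c (m + n)) V"
    by (simp add: evolvesD[OF assms] sum.distrib sum_distrib_left)
  then show ?case using Suc sum_c by simp
qed simp

section \<open>Positivity and lower bounds on the mass\<close>

lemma evolves_nonneg:
  assumes "evolves m y" "\<And>r. r \<in> V \<Longrightarrow> 0 \<le> y 0 r" "r \<in> V"
  shows "0 \<le> y n r"
  using assms(3)
proof (induction n arbitrary: r)
  case (Suc n)
  let ?q = "p (Suc (m + n))"
  show ?case
  proof (cases "r = ?q")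
    case True
    then show ?thesis by (simp add: evolvesD[OF assms(1)] c_removed)
  next
    case False
    then have "0 \<le> c (m + n) r" using c_lower[OF Suc.prems False] eps_pos by simp
    then show ?thesis using Suc.IH[OF Suc.prems] Suc.IH[OF p_in]
      by (simp add: evolvesD[OF assms(1)])
  qed
qed (use assms in simp)

text \<open>The vertex emptied next differs from the one emptied last, so it already carries the
  current bound, and it passes at least the fraction \<open>\<epsilon>\<close> of this to every
  other vertex.\<close>

lemma evolves_lower_propagate:
  assumes y: "evolves m y" and nonneg: "\<And>r. r \<in> V \<Longrightarrow> 0 \<le> y 0 r"
    and start: "a \<le> y i (p (Suc (m + i)))" and "0 \<le> a"
  shows "s \<in> V \<Longrightarrow> s \<noteq> p (m + (Suc i + j)) \<Longrightarrow> \<epsilon> ^ Suc j * a \<le> y (Suc i + j) s"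
proof (induction j arbitrary: s)
  case 0
  have "\<epsilon> * a \<le> c (m + i) s * y i (p (Suc (m + i)))"
    using c_lower[of s "m + i"] 0 eps_pos start \<open>0 \<le> a\<close> by (intro mult_mono) auto
  moreover have "0 \<le> y i s" using evolves_nonneg[OF y nonneg] 0 by simp
  ultimately show ?case by (simp add: evolvesD[OF y] mult.commute)
next
  case (Suc j)
  let ?n = "Suc i + j"
  have neq: "s \<noteq> p (Suc (m + ?n))" using Suc.prems by simp
  have "p (Suc (m + ?n)) \<noteq> p (m + ?n)" by (rule p_Suc_neq)
  then have IH: "\<epsilon> ^ Suc j * a \<le> y ?n (p (Suc (m + ?n)))"
    by (rule Suc.IH[OF p_in])
  have "\<epsilon> * (\<epsilon> ^ Suc j * a) \<le> c (m + ?n) s * y ?n (p (Suc (m + ?n)))"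
    using c_lower[OF Suc.prems(1) neq] IH eps_pos \<open>0 \<le> a\<close> by (intro mult_mono) auto
  also have "\<dots> \<le> y (Suc ?n) s"
    using evolves_nonneg[OF y nonneg Suc.prems(1), of ?n] by (simp only: evolvesD[OF y]) simp
  finally show ?case by (simp add: mult_ac)
qed

text \<open>Some vertex carries at least the average mass and keeps it until it is first emptied.
  The window visits it, and from then on the bound spreads to all vertices except the one emptied
  last.\<close>

lemma evolves_lower:
  assumes y: "evolves m y" and nonneg: "\<And>r. r \<in> V \<Longrightarrow> 0 \<le> y 0 r"
    and cover: "V \<subseteq> p ` {m<..m + L}"
    and s: "s \<in> V" "s \<noteq> p (m + L)"
  shows "\<epsilon> ^ L / card V * sum (y 0) V \<le> y L s"
proof -
  define a where "a = sum (y 0) V / card V"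
  have V: "card V > 0" using finite_V p_in card_gt_0_iff by blast
  have a: "0 \<le> a" using nonneg by (simp add: a_def sum_nonneg)
  obtain r where r: "r \<in> V" "a \<le> y 0 r"
  proof (rule ccontr)
    assume "\<not> thesis"
    then have "\<And>r. r \<in> V \<Longrightarrow> y 0 r < a" using that by force
    then have "sum (y 0) V < (\<Sum>r\<in>V. a)"
      using finite_V V by (intro sum_strict_mono) auto
    then show False using V by (simp add: a_def)
  qed
  \<comment> \<open>Up to the first emptying of \<open>r\<close> the mass there can only
    grow.\<close>
  define i where "i = (LEAST i. p (Suc (m + i)) = r)"
  from cover r(1) obtain n where n: "m < n" "n \<le> m + L" "p n = r" by fastforce
  then have ex: "p (Suc (m + (n - Suc m))) = r" by simp
  then have i: "p (Suc (m + i)) = r" unfolding i_def by (rule LeastI)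
  have "i \<le> n - Suc m" unfolding i_def using ex by (rule Least_le)
  then have iL: "Suc i \<le> L" using n by simp
  have "a \<le> y j r" if "j \<le> i" for j
    using that
  proof (induction j)
    case (Suc j)
    then have "p (Suc (m + j)) \<noteq> r" unfolding i_def using not_less_Least Suc_le_lessD by blast
    then have "0 \<le> c (m + j) r" using c_lower[OF r(1)] eps_pos by force
    moreover have "0 \<le> y j (p (Suc (m + j)))" by (rule evolves_nonneg[OF y nonneg p_in])
    ultimately show ?case using Suc by (simp add: evolvesD[OF y] add_increasing2)
  qed (use r in simp)
  then have "a \<le> y i (p (Suc (m + i)))" using i by simp
  from evolves_lower_propagate[OF y nonneg this a, of s "L - Suc i"] s iL
  have "\<epsilon> ^ (L - i) * a \<le> y L s" by (simp add: Suc_diff_Suc)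
  \<comment> \<open>The exponent \<open>L - i\<close> depends on the vertex found;
    \<open>\<epsilon> \<le> 1\<close> allows replacing it by \<open>L\<close>.\<close>
  moreover have "\<epsilon> ^ L * a \<le> \<epsilon> ^ (L - i) * a"
    using eps_pos eps_le_1 a by (intro mult_right_mono power_decreasing) auto
  ultimately show ?thesis by (simp add: a_def)
qed

section \<open>Contraction of the absolute sum\<close>

lemma evolves_nonexpansive:
  assumes y: "evolves m y"
  shows "(\<Sum>r\<in>V. \<bar>y (n + j) r\<bar>) \<le> (\<Sum>r\<in>V. \<bar>y n r\<bar>)"
proof (induction j)
  case (Suc j)
  let ?k = "n + j" let ?q = "p (Suc (m + ?k))"
  have "(\<Sum>r\<in>V. \<bar>y (Suc ?k) r\<bar>) = (\<Sum>r\<in>V - {?q}. \<bar>y (Suc ?k) r\<bar>)"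
    using sum.remove[OF finite_V p_in, of "\<lambda>r. \<bar>y (Suc ?k) r\<bar>" "Suc (m + ?k)"]
    by (simp add: evolvesD[OF y] c_removed)
  \<comment> \<open>By the triangle inequality the content of the emptied vertex adds at most its
    absolute value, split by positive shares with sum 1.\<close>
  also have "\<dots> \<le> (\<Sum>r\<in>V - {?q}. \<bar>y ?k r\<bar> + \<bar>y ?k ?q\<bar> * c (m + ?k) r)"
  proof (intro sum_mono)
    fix r assume "r \<in> V - {?q}"
    then have "0 \<le> c (m + ?k) r" using c_lower[of r "m + ?k"] eps_pos by force
    then show "\<bar>y (Suc ?k) r\<bar> \<le> \<bar>y ?k r\<bar> + \<bar>y ?k ?q\<bar> * c (m + ?k) r"
      by (simp add: evolvesD[OF y]) (metis abs_mult abs_of_nonneg abs_triangle_ineq)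
  qed
  also have "\<dots> = (\<Sum>r\<in>V. \<bar>y ?k r\<bar>)"
    using sum.remove[OF finite_V p_in, of "\<lambda>r. \<bar>y ?k r\<bar>" "Suc (m + ?k)"]
    by (simp add: sum.distrib sum_distrib_left[symmetric] sum_c_others)
  finally show ?case using Suc by simp
qed simp

text \<open>The positive and negative parts of \<open>y 0\<close> have equal mass
  \<open>\<mu>\<close> and evolve as nonnegative distributions. Both leave at least
  \<open>\<theta> * \<mu>\<close>, with \<open>\<theta> = \<epsilon> ^ L / card V\<close>, at one
  common vertex, where that much cancels: a Doeblin-type argument.\<close>

lemma evolves_contraction:
  assumes y: "evolves m y" and zero: "sum (y 0) V = 0"
    and cover: "V \<subseteq> p ` {m<..m + L}"
  shows "(\<Sum>r\<in>V. \<bar>y L r\<bar>) \<le> (1 - \<epsilon> ^ L / card V) * (\<Sum>r\<in>V. \<bar>y 0 r\<bar>)"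
proof -
  let ?\<theta> = "\<epsilon> ^ L / card V"
  obtain a where a: "evolves m a" "a 0 = (\<lambda>r. max (y 0 r) 0)"
    using evolves_exists by blast
  obtain b where b: "evolves m b" "b 0 = (\<lambda>r. max (- y 0 r) 0)"
    using evolves_exists by blast
  have yab: "y n r = a n r - b n r" for n r
    using evolves_unique[OF y evolves_diff[OF a(1) b(1)], of n] by (simp add: a b max_def fun_eq_iff)
  define \<mu> where "\<mu> = sum (a 0) V"
  have \<mu>b: "sum (b 0) V = \<mu>"
    using zero by (simp add: \<mu>_def yab[of 0] sum_subtractf)
  have norm0: "(\<Sum>r\<in>V. \<bar>y 0 r\<bar>) = 2 * \<mu>"
  proof -
    have "(\<Sum>r\<in>V. \<bar>y 0 r\<bar>) = (\<Sum>r\<in>V. a 0 r + b 0 r)"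
      by (intro sum.cong) (auto simp: a b)
    then show ?thesis by (simp add: sum.distrib \<mu>b) (simp add: \<mu>_def)
  qed
  \<comment> \<open>\<open>p (Suc (m + L))\<close> is such a vertex.\<close>
  obtain s where s: "s \<in> V" "s \<noteq> p (m + L)"
    using p_in p_Suc_neq by metis
  have as: "?\<theta> * \<mu> \<le> a L s"
    unfolding \<mu>_def by (rule evolves_lower[OF a(1) _ cover s]) (simp add: a)
  have bs: "?\<theta> * \<mu> \<le> b L s"
    unfolding \<mu>b[symmetric] by (rule evolves_lower[OF b(1) _ cover s]) (simp add: b)
  have nonneg: "0 \<le> a L r" "0 \<le> b L r" if "r \<in> V" for r
    by (rule evolves_nonneg[OF a(1) _ that]; simp add: a) (rule evolves_nonneg[OF b(1) _ that]; simp add: b)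
  have "(\<Sum>r\<in>V. \<bar>y L r\<bar>) = \<bar>y L s\<bar> + (\<Sum>r\<in>V - {s}. \<bar>y L r\<bar>)"
    by (rule sum.remove[OF finite_V s(1)])
  \<comment> \<open>At \<open>s\<close>, \<open>\<bar>a - b\<bar> = a + b - 2 * min a b\<close>
    yields the gain; elsewhere the triangle inequality suffices.\<close>
  also have "\<dots> \<le> (a L s + b L s - 2 * (?\<theta> * \<mu>)) + (\<Sum>r\<in>V - {s}. a L r + b L r)"
    using as bs nonneg by (intro add_mono sum_mono) (auto simp: yab abs_le_iff add_increasing add_increasing2)
  also have "\<dots> = (\<Sum>r\<in>V. a L r + b L r) - 2 * (?\<theta> * \<mu>)"
    using sum.remove[OF finite_V s(1), of "\<lambda>r. a L r + b L r"] by simp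
  also have "\<dots> = 2 * \<mu> - 2 * (?\<theta> * \<mu>)"
    using evolves_sum[OF a(1), of L] evolves_sum[OF b(1), of L] by (simp add: sum.distrib \<mu>b) (simp add: \<mu>_def)
  finally show ?thesis by (simp add: norm0 algebra_simps)
qed

text \<open>The contraction is iterated over blocks of length \<open>L\<close>, and an incomplete
  last block costs a constant factor. \<open>C\<close> and \<open>\<rho>\<close> do not depend on
  \<open>y\<close>.\<close>

lemma evolves_exponential:
  assumes L: "L > 0" and cover: "\<And>m. V \<subseteq> p ` {m<..m + L}"
  obtains C \<rho> where "0 < \<rho>" "\<rho> < 1" "0 < C"
    "\<And>y n. evolves 0 y \<Longrightarrow> sum (y 0) V = 0 \<Longrightarrow>
       (\<Sum>r\<in>V. \<bar>y n r\<bar>) \<le> C * \<rho> ^ n * (\<Sum>r\<in>V. \<bar>y 0 r\<bar>)"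
proof -
  define \<theta> where "\<theta> = \<epsilon> ^ L / card V"
  \<comment> \<open>At least two vertices give \<open>\<theta> \<le> 1 / 2\<close>, hence a positive
    root \<open>\<rho>\<close>.\<close>
  have "card {p 0, p 1} \<le> card V" using p_in finite_V by (intro card_mono) auto
  then have V: "card V \<ge> 2" using p_Suc_neq[of 0] by simp
  have "\<epsilon> ^ L \<le> 1" using eps_pos eps_le_1 by (simp add: power_le_one)
  then have \<theta>: "0 < \<theta>" "\<theta> < 1"
    using V eps_pos by (auto simp: \<theta>_def divide_simps)
  define \<rho> where "\<rho> = root L (1 - \<theta>)"
  have \<rho>: "0 < \<rho>" "\<rho> < 1" "\<rho> ^ L = 1 - \<theta>"
    using \<theta> L by (auto simp: \<rho>_def)
  have bound: "(\<Sum>r\<in>V. \<bar>y n r\<bar>) \<le> 1 / (1 - \<theta>) * \<rho> ^ n * (\<Sum>r\<in>V. \<bar>y 0 r\<bar>)"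
    if y: "evolves 0 y" and zero: "sum (y 0) V = 0" for y n
  proof -
    let ?N = "\<lambda>n. \<Sum>r\<in>V. \<bar>y n r\<bar>"
    have blocks: "?N (L * a) \<le> (1 - \<theta>) ^ a * ?N 0" for a
    proof (induction a)
      case (Suc a)
      have "?N (L * a + L) \<le> (1 - \<theta>) * ?N (L * a)"
        using evolves_contraction[OF evolves_shift[OF y, of "L * a"] _ cover] evolves_sum[OF y, of "L * a"] zero
        by (simp add: \<theta>_def)
      also have "\<dots> \<le> (1 - \<theta>) * ((1 - \<theta>) ^ a * ?N 0)"
        using Suc \<theta> by (intro mult_left_mono) auto
      finally show ?case by (simp add: algebra_simps)
    qed simp
    have "?N n = ?N (L * (n div L) + n mod L)" by simp
    also have "\<dots> \<le> ?N (L * (n div L))" by (rule evolves_nonexpansive[OF y])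
    also have "\<dots> \<le> (1 - \<theta>) ^ (n div L) * ?N 0" by (rule blocks)
    also have "\<dots> \<le> (1 / (1 - \<theta>) * \<rho> ^ n) * ?N 0"
    proof (intro mult_right_mono sum_nonneg)
      have "\<rho> ^ n = (1 - \<theta>) ^ (n div L) * \<rho> ^ (n mod L)"
        by (metis \<rho>(3) mult_div_mod_eq power_add power_mult)
      \<comment> \<open>The remainder is shorter than \<open>L\<close>, so it accounts for at most
        one factor \<open>\<rho> ^ L\<close>.\<close>
      moreover have "1 - \<theta> \<le> \<rho> ^ (n mod L)"
        unfolding \<rho>(3)[symmetric] using \<rho> L by (intro power_decreasing) (auto intro: less_imp_le)
      ultimately have "(1 - \<theta>) ^ (n div L) * (1 - \<theta>) \<le> \<rho> ^ n"
        using \<theta> by (simp add: mult_left_mono)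
      then show "(1 - \<theta>) ^ (n div L) \<le> 1 / (1 - \<theta>) * \<rho> ^ n"
        using \<theta> by (simp add: pos_le_divide_eq)
    qed simp
    finally show ?thesis .
  qed
  show ?thesis by (rule that[OF \<rho>(1,2) _ bound]) (use \<theta> in simp)
qed

end

section \<open>Barycentric coordinates of the regular simplex\<close>

text \<open>The gradient of the coordinate function \<open>bary V p\<close>: twice the vector from
  the centroid to \<open>p\<close>.\<close>

definition bary_dir :: "'a::euclidean_space set \<Rightarrow> 'a \<Rightarrow> 'a" where
  "bary_dir V p = 2 *\<^sub>R (p - (1 / card V) *\<^sub>R \<Sum>V)"

text \<open>
  The coefficients of \<open>x \<bullet> x\<close> cancel, so this is affine in \<open>x\<close>; with unit edges it takes the value
  1 at \<open>p\<close> and 0 at the other vertices.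
\<close>

definition bary :: "'a::euclidean_space set \<Rightarrow> 'a \<Rightarrow> 'a \<Rightarrow> real" where
  "bary V p x = (1 + (\<Sum>q\<in>V. (dist x q)\<^sup>2)) / card V - (dist x p)\<^sup>2"

lemma dist_square_expand:
  fixes x q :: "'a::real_inner"
  shows "(dist x q)\<^sup>2 = x \<bullet> x - 2 * (x \<bullet> q) + q \<bullet> q"
  by (simp add: dist_norm power2_norm_eq_inner inner_diff inner_commute)

locale pyramid =
  fixes V :: "'a::euclidean_space set"
  assumes equilateral: "equilateral_unit_pyramid V"
begin

lemma finite_V: "finite V" and card_V: "card V = DIM('a) + 1"
  and dist_V: "p \<in> V \<Longrightarrow> q \<in> V \<Longrightarrow> p \<noteq> q \<Longrightarrow> dist p q = 1"
  using equilateral by (auto simp: equilateral_unit_pyramid_def)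

lemma bary_affine:
  "bary V p x = x \<bullet> bary_dir V p + ((1 + (\<Sum>q\<in>V. q \<bullet> q)) / card V - p \<bullet> p)"
proof -
  have "(\<Sum>q\<in>V. (dist x q)\<^sup>2) = card V * (x \<bullet> x) - 2 * (x \<bullet> \<Sum>V) + (\<Sum>q\<in>V. q \<bullet> q)"
    by (simp add: dist_square_expand sum.distrib sum_subtractf sum_distrib_left[symmetric] inner_sum_right)
  then show ?thesis
    using card_V unfolding bary_def bary_dir_def
    by (simp add: dist_square_expand inner_diff_right divide_simps) (simp add: algebra_simps)
qed

lemma bary_add: "bary V p (x + t *\<^sub>R u) = bary V p x + t * (u \<bullet> bary_dir V p)"
  by (simp add: bary_affine inner_add_left)

lemma bary_diff: "bary V p x - bary V p y = (x - y) \<bullet> bary_dir V p"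
  by (simp add: bary_affine inner_diff_left)

lemma bary_vertex:
  assumes "p \<in> V" "q \<in> V"
  shows "bary V p q = (if p = q then 1 else 0)"
proof -
  have "(\<Sum>r\<in>V. (dist q r)\<^sup>2) = (\<Sum>r\<in>V - {q}. (dist q r)\<^sup>2)"
    using sum.remove[OF finite_V assms(2), of "\<lambda>r. (dist q r)\<^sup>2"] by simp
  also have "\<dots> = (\<Sum>r\<in>V - {q}. 1)"
    using assms dist_V by (intro sum.cong) auto
  also have "\<dots> = DIM('a)"
    using assms card_V finite_V by simp
  finally show ?thesis
    using assms card_V dist_V[of q p] by (auto simp: bary_def divide_simps)
qed

lemma sum_bary: "(\<Sum>p\<in>V. bary V p x) = 1"
  using card_V by (simp add: bary_def sum_subtractf)

lemma sum_bary_dir: "(\<Sum>p\<in>V. u \<bullet> bary_dir V p) = 0"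
  using sum_bary[of "0 + 1 *\<^sub>R u"] unfolding bary_add by (simp add: sum.distrib sum_bary)

text \<open>Affine functions commute with affine combinations: as the coefficients sum to 1, the
  constant term can be distributed over them.\<close>

lemma bary_combination:
  assumes "U \<subseteq> V" "sum u U = 1" "p \<in> V"
  shows "bary V p (\<Sum>q\<in>U. u q *\<^sub>R q) = (if p \<in> U then u p else 0)"
proof -
  let ?k = "(1 + (\<Sum>q\<in>V. q \<bullet> q)) / card V - p \<bullet> p"
  have fin: "finite U" using assms finite_V finite_subset by blast
  have "bary V p (\<Sum>q\<in>U. u q *\<^sub>R q) = (\<Sum>q\<in>U. u q * (q \<bullet> bary_dir V p)) + sum u U * ?k"
    using assms(2) by (simp add: bary_affine inner_sum_left)
  also have "\<dots> = (\<Sum>q\<in>U. u q * bary V p q)"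
    unfolding sum_distrib_right sum.distrib[symmetric] by (simp add: bary_affine distrib_left)
  also have "\<dots> = (\<Sum>q\<in>U. if p = q then u q else 0)"
    using assms by (intro sum.cong) (auto simp: bary_vertex)
  finally show ?thesis using fin by simp
qed

text \<open>In a dependence the coefficients sum to zero, so the constant term of
  \<open>bary V p\<close> drops out, and its values at the vertices isolate the coefficient of
  \<open>p\<close>.\<close>

lemma affine_independent_V: "\<not> affine_dependent V"
proof
  assume "affine_dependent V"
  then obtain U p where U: "sum U V = 0" "p \<in> V" "U p \<noteq> 0" "(\<Sum>q\<in>V. U q *\<^sub>R q) = 0"
    using affine_dependent_explicit_finite[OF finite_V] by blast
  let ?k = "(1 + (\<Sum>q\<in>V. q \<bullet> q)) / card V - p \<bullet> p"
  have "0 = (\<Sum>q\<in>V. U q *\<^sub>R q) \<bullet> bary_dir V p + sum U V * ?k" using U by simp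
  also have "\<dots> = (\<Sum>q\<in>V. U q * bary V p q)"
    unfolding inner_sum_left sum_distrib_right sum.distrib[symmetric] by (simp add: bary_affine distrib_left)
  also have "\<dots> = (\<Sum>q\<in>V. if p = q then U q else 0)"
    using U by (intro sum.cong) (auto simp: bary_vertex)
  finally show False using U finite_V by simp
qed

text \<open>\<open>DIM('a) + 1\<close> affinely independent points span the space, and the
  coefficients of an affine combination are its coordinates.\<close>

lemma bary_representation: "x = (\<Sum>p\<in>V. bary V p x *\<^sub>R p)"
proof -
  have "x \<in> affine hull V"
    using affine_independent_span_eq[OF affine_independent_V] card_V by simp
  then obtain u where u: "sum u V = 1" "(\<Sum>p\<in>V. u p *\<^sub>R p) = x"
    using affine_hull_finite[OF finite_V] by auto
  then have "bary V p x = u p" if "p \<in> V" for p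
    using bary_combination[of V u p] that by auto
  then show ?thesis using u by simp
qed

lemma bary_unique: "(\<And>p. p \<in> V \<Longrightarrow> bary V p x = bary V p y) \<Longrightarrow> x = y"
  by (subst (1 2) bary_representation) (simp cong: sum.cong)

text \<open>Stated for arbitrary \<open>U\<close> to serve both the pyramid, \<open>U = V\<close>,
  and its facets, \<open>U = V - {p}\<close>. Geometry is from here on read off from the signs of
  coordinates.\<close>

lemma mem_hull_subset_iff:
  assumes "U \<subseteq> V"
  shows "x \<in> convex hull U \<longleftrightarrow> (\<forall>p\<in>V. 0 \<le> bary V p x) \<and> (\<forall>p\<in>V - U. bary V p x = 0)"
    and "x \<in> rel_interior (convex hull U) \<longleftrightarrow>
           (\<forall>p\<in>U. 0 < bary V p x) \<and> (\<forall>p\<in>V - U. bary V p x = 0)"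
proof -
  have fin: "finite U" using assms finite_V finite_subset by blast
  have rep: "sum (\<lambda>p. bary V p x) U = 1 \<and> (\<Sum>p\<in>U. bary V p x *\<^sub>R p) = x"
    if "\<forall>p\<in>V - U. bary V p x = 0"
  proof -
    have "sum (\<lambda>p. bary V p x) U = sum (\<lambda>p. bary V p x) V"
      using that assms finite_V by (intro sum.mono_neutral_left) auto
    moreover have "(\<Sum>p\<in>U. bary V p x *\<^sub>R p) = (\<Sum>p\<in>V. bary V p x *\<^sub>R p)"
      using that assms finite_V by (intro sum.mono_neutral_left) auto
    ultimately show ?thesis by (simp add: sum_bary bary_representation[symmetric])
  qed
  show "x \<in> convex hull U \<longleftrightarrow> (\<forall>p\<in>V. 0 \<le> bary V p x) \<and> (\<forall>p\<in>V - U. bary V p x = 0)"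
    (is "?l \<longleftrightarrow> ?r")
  proof
    assume ?l
    then show ?r using convex_hull_finite[OF fin] bary_combination[OF assms] assms by auto
  next
    assume ?r
    then show ?l unfolding convex_hull_finite[OF fin]
      by (intro CollectI exI[of _ "\<lambda>p. bary V p x"]) (use rep assms in auto)
  qed
  have ind: "\<not> affine_dependent U"
    using affine_independent_V affine_dependent_subset assms by blast
  show "x \<in> rel_interior (convex hull U) \<longleftrightarrow>
           (\<forall>p\<in>U. 0 < bary V p x) \<and> (\<forall>p\<in>V - U. bary V p x = 0)" (is "?l \<longleftrightarrow> ?r")
  proof
    assume ?l
    then show ?r using rel_interior_convex_hull_explicit[OF ind] bary_combination[OF assms] assms by auto
  next
    assume ?r
    then show ?l unfolding rel_interior_convex_hull_explicit[OF ind]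
      by (intro CollectI exI[of _ "\<lambda>p. bary V p x"]) (use rep assms in auto)
  qed
qed

lemma mem_hull_iff: "x \<in> convex hull V \<longleftrightarrow> (\<forall>p\<in>V. 0 \<le> bary V p x)"
  by (simp add: mem_hull_subset_iff)

lemma mem_interior_iff: "x \<in> interior (convex hull V) \<longleftrightarrow> (\<forall>p\<in>V. 0 < bary V p x)"
proof -
  have "affine hull (convex hull V) = UNIV"
    using affine_independent_span_eq[OF affine_independent_V] card_V by simp
  then have "interior (convex hull V) = rel_interior (convex hull V)"
    by (simp add: rel_interior_interior)
  then show ?thesis by (simp add: mem_hull_subset_iff)
qed

lemma mem_frontier_iff:
  "x \<in> frontier (convex hull V) \<longleftrightarrow> (\<forall>p\<in>V. 0 \<le> bary V p x) \<and> (\<exists>p\<in>V. bary V p x = 0)"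
proof -
  have "closed (convex hull V)"
    using finite_V by (simp add: compact_imp_closed finite_imp_compact_convex_hull)
  then show ?thesis
    by (force simp: frontier_def mem_interior_iff mem_hull_iff)
qed

lemma mem_face_iff:
  assumes "p \<in> V"
  shows "x \<in> face V p \<longleftrightarrow> (\<forall>q\<in>V. 0 \<le> bary V q x) \<and> bary V p x = 0"
proof -
  have "V - (V - {p}) = {p}" using assms by auto
  then show ?thesis unfolding face_def by (simp add: mem_hull_subset_iff)
qed

lemma mem_rel_interior_face_iff:
  assumes "p \<in> V"
  shows "x \<in> rel_interior (face V p) \<longleftrightarrow> (\<forall>q\<in>V - {p}. 0 < bary V q x) \<and> bary V p x = 0"
proof -
  have "V - (V - {p}) = {p}" using assms by auto
  then show ?thesis unfolding face_def by (simp add: mem_hull_subset_iff)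
qed

text \<open>Together with \<open>sum_bary_diff_le\<close> this makes the absolute sum of coordinate
  differences equivalent to the distance, so that contraction carries over to points.\<close>

lemma dist_le_sum_bary:
  "dist x y \<le> (\<Sum>p\<in>V. norm p) * (\<Sum>p\<in>V. \<bar>bary V p x - bary V p y\<bar>)"
proof -
  have "x - y = (\<Sum>p\<in>V. bary V p x *\<^sub>R p) - (\<Sum>p\<in>V. bary V p y *\<^sub>R p)"
    by (simp add: bary_representation[symmetric])
  also have "\<dots> = (\<Sum>p\<in>V. (bary V p x - bary V p y) *\<^sub>R p)"
    by (simp add: sum_subtractf scaleR_diff_left)
  finally have "dist x y = norm (\<Sum>p\<in>V. (bary V p x - bary V p y) *\<^sub>R p)"
    by (simp add: dist_norm)
  also have "\<dots> \<le> (\<Sum>p\<in>V. norm ((bary V p x - bary V p y) *\<^sub>R p))"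
    by (rule norm_sum)
  also have "\<dots> \<le> (\<Sum>p\<in>V. (\<Sum>p\<in>V. norm p) * \<bar>bary V p x - bary V p y\<bar>)"
    using finite_V by (intro sum_mono) (simp add: mult.commute[of "\<bar>_\<bar>"] mult_right_mono member_le_sum)
  finally show ?thesis by (simp add: sum_distrib_left)
qed

lemma bary_diff_le: "\<bar>bary V p x - bary V p y\<bar> \<le> norm (bary_dir V p) * dist x y"
  unfolding bary_diff using Cauchy_Schwarz_ineq2[of "x - y" "bary_dir V p"]
  by (simp add: dist_norm mult.commute)

lemma sum_bary_diff_le:
  "(\<Sum>p\<in>V. \<bar>bary V p x - bary V p y\<bar>) \<le> (\<Sum>p\<in>V. norm (bary_dir V p)) * dist x y"
  unfolding sum_distrib_right by (intro sum_mono bary_diff_le)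


end

section \<open>Switched servers\<close>

lemma periodic_add_mult:
  fixes f :: "nat \<Rightarrow> 'b"
  assumes "\<And>n. f (n + P) = f n"
  shows "f (n + j * P) = f n"
proof (induction j)
  case (Suc j)
  then show ?case using assms[of "n + j * P"] by (simp add: algebra_simps)
qed simp

lemma range_shift_periodic:
  fixes f :: "nat \<Rightarrow> 'b"
  assumes "\<And>n. f (n + P) = f n" "P > 0"
  shows "range (\<lambda>n. f (n + i)) = range f"
proof
  show "range f \<subseteq> range (\<lambda>n. f (n + i))"
  proof
    fix y assume "y \<in> range f"
    then obtain n where "y = f n" by auto
    \<comment> \<open>Adding \<open>i\<close> full periods before subtracting \<open>i\<close> keeps
      the difference of natural numbers exact.\<close>
    also have "\<dots> = f ((n + i * P - i) + i)"
      using periodic_add_mult[of f P n i, OF assms(1)] assms(2) by (simp add: trans_le_add2)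
    finally show "y \<in> range (\<lambda>n. f (n + i))" by blast
  qed
qed auto

lemma periodic_window_cover:
  fixes p :: "nat \<Rightarrow> 'b"
  assumes per: "\<And>n. p (n + P) = p n" and P: "P > 0"
    and visits: "\<And>r N. r \<in> V \<Longrightarrow> \<exists>n\<ge>N. p n = r"
  shows "V \<subseteq> p ` {m<..m + P}"
proof
  fix r assume "r \<in> V"
  then obtain n where n: "n \<ge> Suc m" "p n = r" using visits by blast
  \<comment> \<open>The representative of \<open>n\<close> modulo \<open>P\<close> in the window
    beginning at \<open>Suc m\<close>.\<close>
  define a where "a = Suc m + (n - Suc m) mod P"
  have "n = a + ((n - Suc m) div P) * P"
    using n(1) mod_div_mult_eq[of "n - Suc m" P] unfolding a_def by linarith
  then have "p a = r" using periodic_add_mult[of p P, OF per] n(2) by metis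
  moreover have "a \<in> {m<..m + P}"
    using mod_less_divisor[OF P, of "n - Suc m"] by (auto simp: a_def simp del: mod_less_divisor)
  ultimately show "r \<in> p ` {m<..m + P}" by blast
qed

lemma finite_positive_lower_bound:
  fixes f :: "'b \<Rightarrow> real"
  assumes "finite A" "\<And>a. a \<in> A \<Longrightarrow> 0 < f a"
  shows "\<exists>\<epsilon>>0. \<forall>a\<in>A. \<epsilon> \<le> f a"
proof (intro exI conjI ballI)
  show "0 < Min (insert 1 (f ` A))" using assms by simp
  show "Min (insert 1 (f ` A)) \<le> f a" if "a \<in> A" for a using assms that by (intro Min_le) auto
qed

text \<open>\<open>dist\<close> on \<open>nat \<times> 'a\<close> is the distance of \<open>real \<times> 'a\<close> after a coercion.\<close>

lemma
  fixes s t :: "nat \<times> 'b::metric_space"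
  shows dist_state_eq: "fst s = fst t \<Longrightarrow> dist s t = dist (snd s) (snd t)"
    and dist_state_fst: "dist s t < 1 \<Longrightarrow> fst s = fst t"
    and dist_state_snd: "dist (snd s) (snd t) \<le> dist s t"
proof -
  obtain k x l y where st: "s = (k, x)" "t = (l, y)" by fastforce
  show "fst s = fst t \<Longrightarrow> dist s t = dist (snd s) (snd t)" by (simp add: st dist_prod_def)
  show "dist s t < 1 \<Longrightarrow> fst s = fst t"
    using dist_fst_le[of "(real k, x)" "(real l, y)"] by (simp add: st dist_real_def)
  show "dist (snd s) (snd t) \<le> dist s t"
    using dist_snd_le[of "(real k, x)" "(real l, y)"] by (simp add: st)
qed

locale switched_server = pyramid V
  for V :: "'a::euclidean_space set" +
  fixes v opp :: "'a \<Rightarrow> nat \<Rightarrow> 'a" and F :: "nat \<Rightarrow> nat"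
  assumes fields: "server_fields V v"
    and correspondence: "field_correspondence V opp"
    and standing: "standing_assumption V v opp"
begin

section \<open>Signs of the fields in barycentric coordinates\<close>

lemma opp_in: "p \<in> V \<Longrightarrow> k < DIM('a) \<Longrightarrow> opp p k \<in> V" "p \<in> V \<Longrightarrow> k < DIM('a) \<Longrightarrow> opp p k \<noteq> p"
  using correspondence unfolding field_correspondence_def bij_betw_def by blast+

lemma norm_field: "p \<in> V \<Longrightarrow> k < DIM('a) \<Longrightarrow> norm (v p k) = 1"
  using fields by (simp add: server_fields_def)

lemma field_inward:
  assumes "p \<in> V" "k < DIM('a)"
  shows "0 < v p k \<bullet> bary_dir V p"
proof -
  have "card (V - {p}) \<noteq> 0" using assms card_V finite_V by simp
  then have "face V p \<noteq> {}" by (metis card.empty convex_hull_eq_empty face_def)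
  then obtain x where x: "x \<in> rel_interior (face V p)"
    using rel_interior_eq_empty[of "face V p"] by (auto simp: face_def)
  then obtain e where e: "e > 0" "x + e *\<^sub>R v p k \<in> interior (convex hull V)"
    using fields assms unfolding server_fields_def by blast
  then have "0 < e * (v p k \<bullet> bary_dir V p)"
    using x assms by (auto simp: mem_interior_iff mem_rel_interior_face_iff bary_add)
  then show ?thesis using e by (simp add: zero_less_mult_iff)
qed

text \<open>The point where the line from the opposite vertex meets its facet has as coordinates
  \<open>s\<close> times the rates along the field, plus 1 at that vertex. Their known signs give
  those of the rates once the sign of \<open>s\<close> is known.\<close>

lemma field_signs:
  assumes "p \<in> V" "k < DIM('a)"
  shows field_opp_neg: "v p k \<bullet> bary_dir V (opp p k) < 0"
    and field_pos: "r \<in> V \<Longrightarrow> r \<noteq> opp p k \<Longrightarrow> 0 < v p k \<bullet> bary_dir V r"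
proof -
  let ?q = "opp p k"
  have q: "?q \<in> V" "p \<in> V - {?q}" using opp_in[OF assms] assms by auto
  then obtain s where "?q + s *\<^sub>R v p k \<in> rel_interior (face V ?q)"
    using standing assms(2) unfolding standing_assumption_def by blast
  then have *: "1 + s * (v p k \<bullet> bary_dir V ?q) = 0"
    "\<And>r. r \<in> V \<Longrightarrow> r \<noteq> ?q \<Longrightarrow> 0 < s * (v p k \<bullet> bary_dir V r)"
    using q by (auto simp: mem_rel_interior_face_iff bary_add bary_vertex split: if_splits)
  \<comment> \<open>The standing assumption leaves the sign of \<open>s\<close> open; it is fixed by
    the field pointing inwards from the facet opposite to \<open>p\<close>.\<close>
  have "0 < s" using *(2)[of p] q field_inward[OF assms] by (auto simp: zero_less_mult_iff)
  then show "v p k \<bullet> bary_dir V ?q < 0"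
    using *(1) by (smt (verit) mult_nonneg_nonneg)
  show "0 < v p k \<bullet> bary_dir V r" if "r \<in> V" "r \<noteq> ?q" for r
    using *(2)[OF that] \<open>0 < s\<close> by (simp add: zero_less_mult_iff)
qed

text \<open>The gain of coordinate \<open>r\<close> per unit of mass taken from the vertex
  \<open>opp p k\<close>.\<close>

definition weight :: "'a \<Rightarrow> nat \<Rightarrow> 'a \<Rightarrow> real" where
  "weight p k r = (v p k \<bullet> bary_dir V r) / - (v p k \<bullet> bary_dir V (opp p k))"

lemma weight_opp: "p \<in> V \<Longrightarrow> k < DIM('a) \<Longrightarrow> weight p k (opp p k) = - 1"
  using field_opp_neg[of p k] by (simp add: weight_def)

lemma weight_pos: "p \<in> V \<Longrightarrow> k < DIM('a) \<Longrightarrow> r \<in> V \<Longrightarrow> r \<noteq> opp p k \<Longrightarrow> 0 < weight p k r"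
  unfolding weight_def using field_opp_neg[of p k] field_pos[of p k r]
  by (intro divide_pos_pos) auto

lemma sum_weight: "sum (weight p k) V = 0"
  unfolding weight_def sum_divide_distrib[symmetric] sum_bary_dir by simp

text \<open>Only the coordinate of \<open>opp p k\<close> decreases along the field, so the flight
  ends when it vanishes; eliminating the flight time leaves a linear formula. If that coordinate is
  already 0, the ray never enters the interior.\<close>

lemma next_collision_iff:
  assumes "p \<in> V" "k < DIM('a)" "x \<in> face V p"
  shows "next_collision (convex hull V) (v p k) x y \<longleftrightarrow>
    0 < bary V (opp p k) x \<and>
    (\<forall>r. bary V r y = bary V r x + bary V (opp p k) x * weight p k r)" (is "?l \<longleftrightarrow> ?r")
proof
  let ?q = "opp p k" let ?u = "v p k"
  note q = opp_in[OF assms(1,2)]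
  note neg = field_opp_neg[OF assms(1,2)]
  note pos = field_pos[OF assms(1,2)]
  have x: "\<And>r. r \<in> V \<Longrightarrow> 0 \<le> bary V r x" using assms by (simp add: mem_face_iff)
  {
    assume ?l
    then obtain t where t: "t > 0" "x + t *\<^sub>R ?u \<in> frontier (convex hull V)" "y = x + t *\<^sub>R ?u"
      unfolding next_collision_def by blast
    then obtain r where r: "r \<in> V" "bary V r x + t * (?u \<bullet> bary_dir V r) = 0"
      by (auto simp: mem_frontier_iff bary_add)
    have "r = ?q"
    proof (rule ccontr)
      assume "r \<noteq> ?q"
      then have "0 < t * (?u \<bullet> bary_dir V r)" using pos[OF r(1)] t by simp
      then show False using r x[OF r(1)] by simp
    qed
    with r have eq: "bary V ?q x = - t * (?u \<bullet> bary_dir V ?q)" by simp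
    moreover have "0 < - t * (?u \<bullet> bary_dir V ?q)"
      using t neg by (simp add: mult_pos_neg)
    moreover have "t * (?u \<bullet> bary_dir V r) = bary V ?q x * weight p k r" for r
      using eq neg by (simp add: weight_def)
    ultimately show ?r using t by (simp add: bary_add)
  }
  {
    assume r: ?r
    define t where "t = bary V ?q x / - (?u \<bullet> bary_dir V ?q)"
    have t: "0 < t" unfolding t_def using r neg by (intro divide_pos_pos) auto
    have tw: "t * (?u \<bullet> bary_dir V r) = bary V ?q x * weight p k r" for r
      by (simp add: t_def weight_def)
    have y: "y = x + t *\<^sub>R ?u"
      using r by (intro bary_unique) (simp add: bary_add tw)
    have tq: "bary V ?q x + t * (?u \<bullet> bary_dir V ?q) = 0"
      using neg by (simp add: t_def)
    have int: "0 < bary V r x + s * (?u \<bullet> bary_dir V r)" if "r \<in> V" "r \<noteq> ?q" "0 < s" for r s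
      using x[OF that(1)] pos[OF that(1,2)] that(3) by (simp add: add_nonneg_pos)
    have "0 < bary V ?q x + s * (?u \<bullet> bary_dir V ?q)" if "s < t" for s
      using mult_strict_right_mono_neg[OF that neg] tq by simp
    with int have "\<forall>s\<in>{0<..<t}. x + s *\<^sub>R ?u \<in> interior (convex hull V)"
      by (metis bary_add greaterThanLessThan_iff mem_interior_iff)
    moreover have "x + t *\<^sub>R ?u \<in> frontier (convex hull V)"
      unfolding mem_frontier_iff bary_add using tq int[OF _ _ t] q by (metis less_imp_le order_refl)
    ultimately show ?l unfolding next_collision_def using t y by blast
  }
qed

section \<open>Itineraries and the symbolic dynamics\<close>

definition itinerary :: "(nat \<Rightarrow> nat \<times> 'a) \<Rightarrow> (nat \<Rightarrow> 'a) \<Rightarrow> bool" where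
  "itinerary z p \<longleftrightarrow> (\<forall>n. p n \<in> V \<and> fst (z n) < DIM('a) \<and> fst (z (Suc n)) = F (fst (z n)) \<and>
     snd (z n) \<in> face V (p n) \<and>
     next_collision (convex hull V) (v (p n) (fst (z n))) (snd (z n)) (snd (z (Suc n))))"

text \<open>Each step hides the facet used under its own existential quantifier, and a point may lie
  on several facets. No condition links successive facets, so choice yields the whole sequence
  \<open>p\<close>.\<close>

lemma server_orbit_iff: "server_orbit V v F z \<longleftrightarrow> (\<exists>p. itinerary z p)"
proof -
  have "server_orbit V v F z \<longleftrightarrow> (\<forall>n. \<exists>q. q \<in> V \<and> fst (z n) < DIM('a) \<and> fst (z (Suc n)) = F (fst (z n)) \<and>
     snd (z n) \<in> face V q \<and>
     next_collision (convex hull V) (v q (fst (z n))) (snd (z n)) (snd (z (Suc n))))"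
    unfolding server_orbit_def server_step_def by (auto simp: split_beta)
  then show ?thesis unfolding itinerary_def choice_iff by simp
qed

lemma itineraryD:
  assumes "itinerary z p"
  shows itinerary_in: "p n \<in> V" and itinerary_less: "fst (z n) < DIM('a)"
    and itinerary_F: "fst (z (Suc n)) = F (fst (z n))"
    and itinerary_face: "snd (z n) \<in> face V (p n)"
    and itinerary_collision:
      "next_collision (convex hull V) (v (p n) (fst (z n))) (snd (z n)) (snd (z (Suc n)))"
  using assms by (auto simp: itinerary_def)

lemma itinerary_nonneg: "itinerary z p \<Longrightarrow> r \<in> V \<Longrightarrow> 0 \<le> bary V r (snd (z n))"
  using itinerary_face[of z p n] itinerary_in[of z p n] by (simp add: mem_face_iff)

lemma itinerary_zero: "itinerary z p \<Longrightarrow> bary V (p n) (snd (z n)) = 0"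
  using itinerary_face[of z p n] itinerary_in[of z p n] by (simp add: mem_face_iff)

text \<open>After a flight every coordinate except that of \<open>opp (p n) (fst (z n))\<close> is
  positive, so the facet used next is forced.\<close>

lemma itinerary_step:
  assumes "itinerary z p"
  shows itinerary_Suc: "p (Suc n) = opp (p n) (fst (z n))"
    and itinerary_pos: "r \<in> V \<Longrightarrow> r \<noteq> p (Suc n) \<Longrightarrow> 0 < bary V r (snd (z (Suc n)))"
    and itinerary_evolves: "bary V r (snd (z (Suc n))) =
          bary V r (snd (z n)) + bary V (p (Suc n)) (snd (z n)) * weight (p n) (fst (z n)) r"
proof -
  let ?q = "opp (p n) (fst (z n))"
  note p = itinerary_in[OF assms, of n] itinerary_less[OF assms, of n]
  have step: "0 < bary V ?q (snd (z n))"
    "\<And>r. bary V r (snd (z (Suc n))) =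
          bary V r (snd (z n)) + bary V ?q (snd (z n)) * weight (p n) (fst (z n)) r"
    using itinerary_collision[OF assms, of n] next_collision_iff[OF p itinerary_face[OF assms]] by auto
  have pos: "0 < bary V r (snd (z (Suc n)))" if "r \<in> V" "r \<noteq> ?q" for r
    using step(2)[of r] step(1) weight_pos[OF p that] itinerary_nonneg[OF assms that(1), of n]
    by (simp add: add_nonneg_pos)
  show q: "p (Suc n) = ?q"
    using pos itinerary_in[OF assms, of "Suc n"] itinerary_zero[OF assms, of "Suc n"] by force
  show "r \<in> V \<Longrightarrow> r \<noteq> p (Suc n) \<Longrightarrow> 0 < bary V r (snd (z (Suc n)))"
    using pos q by simp
  show "bary V r (snd (z (Suc n))) =
          bary V r (snd (z n)) + bary V (p (Suc n)) (snd (z n)) * weight (p n) (fst (z n)) r"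
    using step q by simp
qed

lemma itinerary_shift: "itinerary z p \<Longrightarrow> itinerary (\<lambda>n. z (n + i)) (\<lambda>n. p (n + i))"
  by (simp add: itinerary_def)

text \<open>Facet and field number evolve by themselves under
  \<open>(p, k) \<mapsto> (opp p k, F k)\<close>; positions do not enter.\<close>

lemma itinerary_deterministic:
  assumes "itinerary z p" "itinerary w p'" "p 0 = p' 0" "fst (z 0) = fst (w 0)"
  shows "p n = p' n \<and> fst (z n) = fst (w n)"
proof (induction n)
  case (Suc n)
  then show ?case
    by (simp add: itinerary_Suc[OF assms(1)] itinerary_Suc[OF assms(2)]
        itinerary_F[OF assms(1)] itinerary_F[OF assms(2)])
qed (use assms in simp)

lemma weight_lower_bound:
  obtains \<epsilon> where "0 < \<epsilon>"
    "\<And>p k r. p \<in> V \<Longrightarrow> k < DIM('a) \<Longrightarrow> r \<in> V \<Longrightarrow> r \<noteq> opp p k \<Longrightarrow> \<epsilon> \<le> weight p k r"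
proof -
  let ?A = "{(p, k, r). p \<in> V \<and> k < DIM('a) \<and> r \<in> V \<and> r \<noteq> opp p k}"
  have "finite ?A"
    by (rule finite_subset[of _ "V \<times> {..<DIM('a)} \<times> V"]) (use finite_V in auto)
  then have "\<exists>\<epsilon>>0. \<forall>a\<in>?A. \<epsilon> \<le> (\<lambda>(p, k, r). weight p k r) a"
    by (rule finite_positive_lower_bound) (auto intro: weight_pos)
  then show ?thesis using that by auto
qed

text \<open>The passage from flights to the abstract mass model; consecutive vertices differ because
  no field corresponds to its own facet.\<close>

lemma itinerary_redistribution:
  assumes z: "itinerary z p" and "0 < \<epsilon>"
    and "\<And>p k r. p \<in> V \<Longrightarrow> k < DIM('a) \<Longrightarrow> r \<in> V \<Longrightarrow> r \<noteq> opp p k \<Longrightarrow> \<epsilon> \<le> weight p k r"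
  shows "redistribution V p (\<lambda>n. weight (p n) (fst (z n))) \<epsilon>"
  using assms itinerary_in[OF z] itinerary_less[OF z] finite_V
  by unfold_locales (auto simp: itinerary_Suc[OF z] sum_weight weight_opp opp_in)

section \<open>Orbits sharing the symbols of a given orbit\<close>

definition synchronized :: "(nat \<Rightarrow> nat \<times> 'a) \<Rightarrow> (nat \<Rightarrow> 'a) \<Rightarrow> (nat \<Rightarrow> nat \<times> 'a) \<Rightarrow> bool" where
  "synchronized z p w \<longleftrightarrow> itinerary w p \<and> (\<forall>n. fst (w n) = fst (z n))"

lemma synchronizedD:
  assumes "synchronized z p w"
  shows "itinerary w p" "fst (w n) = fst (z n)"
  using assms by (auto simp: synchronized_def)

lemma synchronized_refl: "itinerary z p \<Longrightarrow> synchronized z p z"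
  by (simp add: synchronized_def)

lemma synchronized_shift:
  assumes "itinerary z p" "\<And>n. p (n + i) = p n" "\<And>n. fst (z (n + i)) = fst (z n)"
  shows "synchronized z p (\<lambda>n. z (n + i))"
  using itinerary_shift[OF assms(1), of i] assms by (simp add: synchronized_def)

text \<open>Equal symbols mean equal linear maps, and the coordinates of each point sum to 1, so the
  coordinate difference of two such orbits is an evolution of total mass zero.\<close>

lemma synchronized_exponential:
  assumes z: "itinerary z p" and L: "L > 0" and cover: "\<And>m. V \<subseteq> p ` {m<..m + L}"
  obtains C \<rho> where "0 < \<rho>" "\<rho> < 1" "0 < C"
    "\<And>w w' n. synchronized z p w \<Longrightarrow> synchronized z p w' \<Longrightarrow>
       dist (snd (w n)) (snd (w' n)) \<le> C * \<rho> ^ n * dist (snd (w 0)) (snd (w' 0))"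
proof -
  obtain \<epsilon> where \<epsilon>: "0 < \<epsilon>"
    "\<And>p k r. p \<in> V \<Longrightarrow> k < DIM('a) \<Longrightarrow> r \<in> V \<Longrightarrow> r \<noteq> opp p k \<Longrightarrow> \<epsilon> \<le> weight p k r"
    by (rule weight_lower_bound) blast
  interpret redistribution V p "\<lambda>n. weight (p n) (fst (z n))" \<epsilon>
    using z \<epsilon> by (rule itinerary_redistribution)
  obtain C \<rho> where C: "0 < \<rho>" "\<rho> < 1" "0 < C"
    "\<And>y n. evolves 0 y \<Longrightarrow> sum (y 0) V = 0 \<Longrightarrow>
       (\<Sum>r\<in>V. \<bar>y n r\<bar>) \<le> C * \<rho> ^ n * (\<Sum>r\<in>V. \<bar>y 0 r\<bar>)"
    by (rule evolves_exponential[OF L cover]) blast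
  define A where "A = (\<Sum>p\<in>V. norm p)"
  define B where "B = (\<Sum>p\<in>V. norm (bary_dir V p))"
  have AB: "0 \<le> A" "0 \<le> B" by (auto simp: A_def B_def sum_nonneg)
  \<comment> \<open>\<open>A\<close> and \<open>B\<close> come from the two norm comparisons and are
    only known to be nonnegative; the summand 1 makes the constant positive.\<close>
  have bound: "dist (snd (w n)) (snd (w' n)) \<le> (A * C * B + 1) * \<rho> ^ n * dist (snd (w 0)) (snd (w' 0))"
    if w: "synchronized z p w" and w': "synchronized z p w'" for w w' n
  proof -
    define y where "y = (\<lambda>n r. bary V r (snd (w n)) - bary V r (snd (w' n)))"
    have "evolves 0 y"
      unfolding evolves_def y_def using synchronizedD[OF w] synchronizedD[OF w']
      by (auto simp: itinerary_evolves[where p = p] algebra_simps)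
    moreover have "sum (y 0) V = 0" by (simp add: y_def sum_subtractf sum_bary)
    ultimately have "(\<Sum>r\<in>V. \<bar>y n r\<bar>) \<le> C * \<rho> ^ n * (\<Sum>r\<in>V. \<bar>y 0 r\<bar>)" by (rule C(4))
    also have "\<dots> \<le> C * \<rho> ^ n * (B * dist (snd (w 0)) (snd (w' 0)))"
      using C(1,3) sum_bary_diff_le[of "snd (w 0)" "snd (w' 0)"]
      unfolding y_def B_def by (intro mult_left_mono) auto
    finally have "A * (\<Sum>r\<in>V. \<bar>y n r\<bar>) \<le> A * (C * \<rho> ^ n * (B * dist (snd (w 0)) (snd (w' 0))))"
      using AB by (intro mult_left_mono)
    moreover have "dist (snd (w n)) (snd (w' n)) \<le> A * (\<Sum>r\<in>V. \<bar>y n r\<bar>)"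
      unfolding A_def y_def by (rule dist_le_sum_bary)
    moreover have "0 \<le> \<rho> ^ n * dist (snd (w 0)) (snd (w' 0))" using C(1) by simp
    ultimately show ?thesis by (simp add: algebra_simps)
  qed
  show ?thesis
    by (rule that[OF C(1,2) _ bound]) (use AB C(3) in \<open>simp add: add_nonneg_pos\<close>)
qed

text \<open>The total mass is 1, so a full window leaves a fixed amount at all vertices but one.
  Being uniform in \<open>n\<close>, the bound survives limits and keeps limit points in the
  relative interiors of facets.\<close>

lemma itinerary_lower_bound:
  assumes z: "itinerary z p" and cover: "\<And>m. V \<subseteq> p ` {m<..m + L}"
  obtains \<eta> where "0 < \<eta>"
    "\<And>n r. r \<in> V \<Longrightarrow> r \<noteq> p (n + L) \<Longrightarrow> \<eta> \<le> bary V r (snd (z (n + L)))"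
proof -
  obtain \<epsilon> where \<epsilon>: "0 < \<epsilon>"
    "\<And>p k r. p \<in> V \<Longrightarrow> k < DIM('a) \<Longrightarrow> r \<in> V \<Longrightarrow> r \<noteq> opp p k \<Longrightarrow> \<epsilon> \<le> weight p k r"
    by (rule weight_lower_bound) blast
  interpret redistribution V p "\<lambda>n. weight (p n) (fst (z n))" \<epsilon>
    using z \<epsilon> by (rule itinerary_redistribution)
  have "evolves n (\<lambda>i r. bary V r (snd (z (n + i))))" for n
    unfolding evolves_def by (simp add: itinerary_evolves[OF z])
  from evolves_lower[OF this _ cover]
  have "\<epsilon> ^ L / card V \<le> bary V r (snd (z (n + L)))" if "r \<in> V" "r \<noteq> p (n + L)" for n r
    using that itinerary_nonneg[OF z] by (simp add: sum_bary)
  moreover have "0 < \<epsilon> ^ L / card V" using \<epsilon> card_V by simp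
  ultimately show ?thesis using that by blast
qed

section \<open>Visits to every facet\<close>

lemma dist_collision:
  assumes "p \<in> V" "k < DIM('a)" "next_collision (convex hull V) (v p k) x y"
  shows "bary V r y - bary V r x = dist x y * (v p k \<bullet> bary_dir V r)"
proof -
  obtain t where "t > 0" "y = x + t *\<^sub>R v p k" using assms(3) by (auto simp: next_collision_def)
  then show ?thesis using norm_field[OF assms(1,2)] by (simp add: bary_add dist_norm)
qed

text \<open>
  The coordinate of a vertex whose facet is no longer hit grows in proportion to the length of the
  path, so it would exceed 1.
\<close>

lemma trajectory_visits:
  assumes traj: "server_trajectory V v F z" and z: "itinerary z p" and r: "r \<in> V"
  shows "\<exists>n\<ge>N. p n = r"
proof (rule ccontr)
  assume "\<not> ?thesis"
  then have never: "\<And>n. n \<ge> N \<Longrightarrow> p n \<noteq> r" by blast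
  \<comment> \<open>The finite set over which the slowest growth rate \<open>\<alpha>\<close> of
    coordinate \<open>r\<close> is taken.\<close>
  let ?A = "{(p, k). p \<in> V \<and> k < DIM('a) \<and> r \<noteq> opp p k}"
  have "finite ?A"
    by (rule finite_subset[of _ "V \<times> {..<DIM('a)}"]) (use finite_V in auto)
  then have "\<exists>\<alpha>>0. \<forall>a\<in>?A. \<alpha> \<le> (\<lambda>(p, k). v p k \<bullet> bary_dir V r) a"
    by (rule finite_positive_lower_bound) (auto intro: field_pos r)
  then obtain \<alpha> where \<alpha>: "\<alpha> > 0"
    "\<And>p k. p \<in> V \<Longrightarrow> k < DIM('a) \<Longrightarrow> r \<noteq> opp p k \<Longrightarrow> \<alpha> \<le> v p k \<bullet> bary_dir V r" by auto
  have growth: "\<alpha> * collision_time z (N + j) \<le> \<alpha> * collision_time z N + bary V r (snd (z (N + j)))" for j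
  proof (induction j)
    case 0
    then show ?case using itinerary_nonneg[OF z r] by simp
  next
    case (Suc j)
    let ?n = "N + j" let ?u = "v (p ?n) (fst (z ?n))"
    have "r \<noteq> opp (p ?n) (fst (z ?n))" using never[of "Suc ?n"] itinerary_Suc[OF z, of ?n] by simp
    then have "\<alpha> \<le> ?u \<bullet> bary_dir V r" by (intro \<alpha> itinerary_in[OF z] itinerary_less[OF z])
    then have "dist (snd (z ?n)) (snd (z (Suc ?n))) * \<alpha> \<le> dist (snd (z ?n)) (snd (z (Suc ?n))) * (?u \<bullet> bary_dir V r)"
      by (intro mult_left_mono) auto
    also have "\<dots> = bary V r (snd (z (Suc ?n))) - bary V r (snd (z ?n))"
      using dist_collision[OF itinerary_in[OF z] itinerary_less[OF z] itinerary_collision[OF z]] by simp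
    finally show ?case using Suc by (simp add: collision_time_def algebra_simps)
  qed
  have le1: "bary V r (snd (z n)) \<le> 1" for n
    using member_le_sum[of r V "\<lambda>r. bary V r (snd (z n))"] r finite_V itinerary_nonneg[OF z]
    by (simp add: sum_bary)
  have bound: "collision_time z n \<le> collision_time z N + 1 / \<alpha>" if "n \<ge> N" for n
  proof -
    have "\<alpha> * collision_time z n \<le> \<alpha> * collision_time z N + 1"
      using growth[of "n - N"] le1[of n] that by simp
    then show ?thesis using \<alpha>(1) by (simp add: field_simps)
  qed
  have "filterlim (collision_time z) at_top sequentially"
    using traj by (simp add: server_trajectory_def)
  then obtain M where "\<And>n. n \<ge> M \<Longrightarrow> collision_time z n > collision_time z N + 1 / \<alpha>"
    by (auto simp: filterlim_at_top_dense eventually_sequentially)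
  from this[of "max M N"] bound[of "max M N"] show False by simp
qed

section \<open>Stability\<close>

lemma stable_orbitI:
  assumes z: "itinerary z p" and L: "L > 0" and cover: "\<And>m. V \<subseteq> p ` {m<..m + L}"
    and interior: "\<And>r. r \<in> V \<Longrightarrow> r \<noteq> p 0 \<Longrightarrow> 0 < bary V r (snd (z 0))"
  shows "stable_orbit V v F z"
proof -
  obtain C \<rho> where C: "0 < \<rho>" "\<rho> < 1" "0 < C"
    "\<And>w w' n. synchronized z p w \<Longrightarrow> synchronized z p w' \<Longrightarrow>
       dist (snd (w n)) (snd (w' n)) \<le> C * \<rho> ^ n * dist (snd (w 0)) (snd (w' 0))"
    using synchronized_exponential[OF z L cover] by metis
  obtain \<eta> where \<eta>: "\<eta> > 0" "\<And>r. r \<in> V - {p 0} \<Longrightarrow> \<eta> \<le> bary V r (snd (z 0))"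
    using finite_positive_lower_bound[of "V - {p 0}" "\<lambda>r. bary V r (snd (z 0))"] finite_V interior
    by auto
  define B where "B = 1 + (\<Sum>r\<in>V. norm (bary_dir V r))"
  have B: "B > 0" by (simp add: B_def add_pos_nonneg sum_nonneg)
  \<comment> \<open>The bound 1 forces the same initial field number, the bound
    \<open>\<eta> / B\<close> the same initial facet.\<close>
  define \<delta> where "\<delta> = min 1 (\<eta> / B)"
  have \<delta>: "\<delta> > 0" using B \<eta> by (simp add: \<delta>_def)
  have close: "dist (w n) (z n) \<le> C * \<rho> ^ n * dist (w 0) (z 0)"
    if orbit: "server_orbit V v F w" and near: "dist (w 0) (z 0) < \<delta>" for w n
  proof -
    obtain p' where w: "itinerary w p'" using orbit server_orbit_iff by blast
    have fst0: "fst (w 0) = fst (z 0)"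
      using near by (intro dist_state_fst) (simp add: \<delta>_def)
    have near_snd: "dist (snd (z 0)) (snd (w 0)) < \<eta> / B"
      using dist_state_snd[of "w 0" "z 0"] near unfolding \<delta>_def by (simp add: dist_commute)
    have p0: "p' 0 = p 0"
    proof (rule ccontr)
      assume "p' 0 \<noteq> p 0"
      \<comment> \<open>Coordinate \<open>p' 0\<close> vanishes at \<open>w 0\<close> but would be
        at least \<open>\<eta>\<close> at \<open>z 0\<close>, and \<open>B\<close> bounds how fast
        coordinates vary.\<close>
      then have "\<eta> \<le> bary V (p' 0) (snd (z 0))" using itinerary_in[OF w] by (intro \<eta>) auto
      also have "\<dots> \<le> norm (bary_dir V (p' 0)) * dist (snd (z 0)) (snd (w 0))"
        using bary_diff_le[of "p' 0" "snd (z 0)" "snd (w 0)"] itinerary_zero[OF w, of 0] by simp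
      also have "\<dots> \<le> B * dist (snd (z 0)) (snd (w 0))"
        using member_le_sum[of "p' 0" V "\<lambda>r. norm (bary_dir V r)"] finite_V itinerary_in[OF w]
        by (intro mult_right_mono) (auto simp: B_def)
      also have "\<dots> < \<eta>" using near_snd B by (simp add: field_simps)
      finally show False by simp
    qed
    \<comment> \<open>Equal initial symbols force equal symbols forever, so the contraction estimate
      applies.\<close>
    have same: "p' n = p n \<and> fst (w n) = fst (z n)" for n
      by (rule itinerary_deterministic[OF w z p0 fst0])
    then have "p' = p" by auto
    with w same have "synchronized z p w" by (simp add: synchronized_def)
    moreover have "dist (w n) (z n) = dist (snd (w n)) (snd (z n))" for n
      using same[of n] by (intro dist_state_eq) simp
    moreover have "dist (w 0) (z 0) = dist (snd (w 0)) (snd (z 0))"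
      using fst0 by (rule dist_state_eq)
    ultimately show ?thesis using C(4)[OF _ synchronized_refl[OF z]] by simp
  qed
  show ?thesis
    unfolding stable_orbit_def
  proof (intro conjI allI impI)
    fix e :: real assume e: "e > 0"
    show "\<exists>r>0. \<forall>w. server_orbit V v F w \<and> dist (w 0) (z 0) < r \<longrightarrow> (\<forall>n. dist (w n) (z n) < e)"
    proof (intro exI[of _ "min \<delta> (e / C)"] conjI allI impI)
      fix w n assume w: "server_orbit V v F w \<and> dist (w 0) (z 0) < min \<delta> (e / C)"
      then have "dist (w n) (z n) \<le> C * \<rho> ^ n * dist (w 0) (z 0)" using close by simp
      also have "\<dots> \<le> C * 1 * dist (w 0) (z 0)"
        using C by (intro mult_right_mono mult_left_mono power_le_one) auto
      also have "\<dots> < e" using w C(3) by (simp add: field_simps)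
      finally show "dist (w n) (z n) < e" .
    qed (use \<delta> e C in simp)
  next
    show "\<exists>r>0. \<forall>w. server_orbit V v F w \<and> dist (w 0) (z 0) < r \<longrightarrow> (\<lambda>n. dist (w n) (z n)) \<longlonglongrightarrow> 0"
    proof (intro exI[of _ \<delta>] conjI allI impI \<delta>)
      fix w assume w: "server_orbit V v F w \<and> dist (w 0) (z 0) < \<delta>"
      have "(\<lambda>n. C * \<rho> ^ n * dist (w 0) (z 0)) \<longlonglongrightarrow> C * 0 * dist (w 0) (z 0)"
        using C by (intro tendsto_intros LIMSEQ_realpow_zero) auto
      then have lim: "(\<lambda>n. C * \<rho> ^ n * dist (w 0) (z 0)) \<longlonglongrightarrow> 0" by simp
      have "norm (dist (w n) (z n)) \<le> C * \<rho> ^ n * dist (w 0) (z 0)" for n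
        using close[of w n] w by simp
      then have "\<forall>\<^sub>F n in sequentially. norm (dist (w n) (z n)) \<le> C * \<rho> ^ n * dist (w 0) (z 0)"
        by (rule always_eventually[OF allI])
      from this lim show "(\<lambda>n. dist (w n) (z n)) \<longlonglongrightarrow> 0" by (rule Lim_null_comparison)
    qed
  qed
qed

section \<open>Periodic limits and exponential convergence\<close>

lemma itinerary_bounded:
  obtains D where "0 < D" "\<And>z p w p' m n. itinerary z p \<Longrightarrow> itinerary w p' \<Longrightarrow> dist (snd (z m)) (snd (w n)) \<le> D"
proof -
  have "bounded (convex hull V)" using finite_V by (simp add: finite_imp_bounded_convex_hull)
  then obtain D where D: "\<And>x y. x \<in> convex hull V \<Longrightarrow> y \<in> convex hull V \<Longrightarrow> dist x y \<le> D"
    by (meson bounded_two_points)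
  have "snd (z n) \<in> convex hull V" if "itinerary z p" for z p n
    using itinerary_nonneg[OF that] by (simp add: mem_hull_iff)
  then show ?thesis using that[of "max D 1"] D by (meson less_max_iff_disj max.coboundedI1 zero_less_one)
qed

text \<open>Shifts by multiples of \<open>P\<close> preserve the symbols, so the shifted orbits are
  Cauchy at each \<open>n\<close>. The coordinate relations pass to the limit; strict positivity is
  saved by the uniform lower bound.\<close>

lemma periodic_symbols_limit:
  assumes z: "itinerary z p" and P: "P > 0"
    and per_p: "\<And>n. p (n + P) = p n" and per_k: "\<And>n. fst (z (n + P)) = fst (z n)"
    and cover: "\<And>m. V \<subseteq> p ` {m<..m + P}"
  obtains w C \<rho> where "stable_periodic_trajectory V v F w" "\<And>n. w (n + P) = w n"
    "0 < \<rho>" "\<rho> < 1" "0 < C" "\<And>n. dist (z n) (w n) \<le> C * \<rho> ^ n"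
proof -
  obtain C \<rho> where C: "0 < \<rho>" "\<rho> < 1" "0 < C"
    "\<And>w w' n. synchronized z p w \<Longrightarrow> synchronized z p w' \<Longrightarrow>
       dist (snd (w n)) (snd (w' n)) \<le> C * \<rho> ^ n * dist (snd (w 0)) (snd (w' 0))"
    using synchronized_exponential[OF z P cover] by metis
  obtain D where D: "0 < D"
    "\<And>z p w p' m n. itinerary z p \<Longrightarrow> itinerary w p' \<Longrightarrow> dist (snd (z m)) (snd (w n)) \<le> D"
    using itinerary_bounded by metis
  have sync_dist: "dist (snd (w n)) (snd (w' n)) \<le> C * D * \<rho> ^ n"
    if "synchronized z p w" "synchronized z p w'" for w w' n
  proof -
    have "dist (snd (w n)) (snd (w' n)) \<le> C * \<rho> ^ n * dist (snd (w 0)) (snd (w' 0))"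
      by (rule C(4)[OF that])
    also have "\<dots> \<le> C * \<rho> ^ n * D"
      using that C by (intro mult_left_mono D(2)[of w p w' p]) (auto simp: synchronized_def)
    finally show ?thesis by (simp add: mult_ac)
  qed
  have shift: "synchronized z p (\<lambda>n. z (n + j * P))" for j
    by (rule synchronized_shift[OF z]) (use periodic_add_mult[of p P, OF per_p] periodic_add_mult[of "\<lambda>n. fst (z n)" P, OF per_k] in auto)
  have "Cauchy (\<lambda>j. snd (z (n + j * P)))" for n
  proof (rule CauchyI')
    fix e :: real assume "e > 0"
    moreover have "(\<lambda>j. C * D * \<rho> ^ j) \<longlonglongrightarrow> C * D * 0"
      using C by (intro tendsto_intros LIMSEQ_realpow_zero) auto
    ultimately obtain M where M: "\<And>j. j \<ge> M \<Longrightarrow> C * D * \<rho> ^ j < e"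
      using order_tendstoD(2)[of _ "C * D * 0" sequentially e] by (auto simp: eventually_sequentially)
    show "\<exists>M. \<forall>i\<ge>M. \<forall>j>i. dist (snd (z (n + i * P))) (snd (z (n + j * P))) < e"
    proof (intro exI allI impI)
      fix i j assume ij: "i \<ge> M" "j > i"
      \<comment> \<open>The later point belongs to \<open>z\<close> shifted by \<open>j - i\<close>
        periods, compared with \<open>z\<close> at time \<open>n + i * P\<close>.\<close>
      have "n + j * P = n + i * P + (j - i) * P" using ij by (simp add: algebra_simps flip: add_mult_distrib)
      then have "dist (snd (z (n + i * P))) (snd (z (n + j * P))) \<le> C * D * \<rho> ^ (n + i * P)"
        using sync_dist[OF synchronized_refl[OF z] shift[of "j - i"], of "n + i * P"] by (simp add: add.assoc)
      also have "\<dots> < e"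
      proof (rule M)
        have "i * 1 \<le> i * P" using P by (intro mult_le_mono) auto
        then show "M \<le> n + i * P" using ij by linarith
      qed
      finally show "dist (snd (z (n + i * P))) (snd (z (n + j * P))) < e" .
    qed
  qed
  then have conv: "convergent (\<lambda>j. snd (z (n + j * P)))" for n by (rule Cauchy_convergent)
  define l where "l = (\<lambda>n. lim (\<lambda>j. snd (z (n + j * P))))"
  have l: "(\<lambda>j. snd (z (n + j * P))) \<longlonglongrightarrow> l n" for n
    using conv[of n] by (simp add: l_def convergent_LIMSEQ_iff)
  define w where "w = (\<lambda>n. (fst (z n), l n))"
  have bary_l: "(\<lambda>j. bary V r (snd (z (n + j * P)))) \<longlonglongrightarrow> bary V r (l n)" for r n
    unfolding bary_affine by (intro tendsto_intros l)
  have per_pj: "p (n + j * P) = p n" and per_kj: "fst (z (n + j * P)) = fst (z n)" for n j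
    using synchronizedD[OF shift[of j]] periodic_add_mult[of p P, OF per_p] by auto
  obtain \<eta> where \<eta>: "\<eta> > 0"
    "\<And>n r. r \<in> V \<Longrightarrow> r \<noteq> p (n + P) \<Longrightarrow> \<eta> \<le> bary V r (snd (z (n + P)))"
    using itinerary_lower_bound[OF z cover] by metis
  \<comment> \<open>The uniform bound holds from time \<open>P\<close> on, hence the sequence starts
    at \<open>Suc j\<close>.\<close>
  have lower: "\<eta> \<le> bary V r (l n)" if "r \<in> V" "r \<noteq> p n" for r n
  proof (rule tendsto_lowerbound[OF LIMSEQ_Suc[OF bary_l]])
    have "\<eta> \<le> bary V r (snd (z (n + Suc j * P)))" for j
    proof -
      have "n + Suc j * P = n + j * P + P" by simp
      then show ?thesis
        using \<eta>(2)[of r "n + j * P"] that per_p[of "n + j * P"] per_pj[of n j] by metis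
    qed
    then show "\<forall>\<^sub>F j in sequentially. \<eta> \<le> bary V r (snd (z (n + Suc j * P)))" by simp
  qed simp
  have zero: "bary V (p n) (l n) = 0" for n
  proof (rule LIMSEQ_unique[OF bary_l])
    have "bary V (p n) (snd (z (n + j * P))) = 0" for j
      using itinerary_zero[OF z, of "n + j * P"] by (simp add: per_pj)
    then show "(\<lambda>j. bary V (p n) (snd (z (n + j * P)))) \<longlonglongrightarrow> 0" by simp
  qed
  have evolves: "bary V r (l (Suc n)) =
      bary V r (l n) + bary V (p (Suc n)) (l n) * weight (p n) (fst (z n)) r" for r n
  proof (rule LIMSEQ_unique)
    show "(\<lambda>j. bary V r (snd (z (Suc n + j * P)))) \<longlonglongrightarrow> bary V r (l (Suc n))" by (rule bary_l)
    have "bary V r (snd (z (Suc n + j * P))) = bary V r (snd (z (n + j * P))) +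
        bary V (p (Suc n)) (snd (z (n + j * P))) * weight (p n) (fst (z n)) r" for j
      using itinerary_evolves[OF z, of r "n + j * P"] per_pj[of "Suc n" j] by (simp add: per_pj per_kj)
    then show "(\<lambda>j. bary V r (snd (z (Suc n + j * P)))) \<longlonglongrightarrow>
        bary V r (l n) + bary V (p (Suc n)) (l n) * weight (p n) (fst (z n)) r"
      by (simp only:) (intro tendsto_intros bary_l)
  qed
  note pV = itinerary_in[OF z] and kd = itinerary_less[OF z]
  have p_neq: "p (Suc n) \<noteq> p n" for n
    using itinerary_Suc[OF z] opp_in[OF pV kd] by simp
  have w: "itinerary w p"
  proof -
    have face: "l n \<in> face V (p n)" for n
      unfolding mem_face_iff[OF pV] using lower zero \<eta>(1) by (metis less_imp_le order.refl order_trans)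
    have "next_collision (convex hull V) (v (p n) (fst (z n))) (l n) (l (Suc n))" for n
      unfolding next_collision_iff[OF pV kd face] itinerary_Suc[OF z, symmetric]
      using evolves lower[OF pV p_neq, of n] \<eta>(1) by (auto intro: less_le_trans)
    with face show ?thesis
      by (simp add: itinerary_def w_def pV kd itinerary_F[OF z])
  qed
  have w_per: "w (n + P) = w n" for n
  proof -
    have "(\<lambda>j. snd (z (n + Suc j * P))) \<longlonglongrightarrow> l n" by (rule LIMSEQ_Suc[OF l])
    then have "(\<lambda>j. snd (z (n + P + j * P))) \<longlonglongrightarrow> l n" by (simp add: add.assoc)
    from LIMSEQ_unique[OF this l[of "n + P"]] show ?thesis by (simp add: w_def per_k)
  qed
  have traj: "server_trajectory V v F w"
  proof -
    define B where "B = 1 + (\<Sum>r\<in>V. norm (bary_dir V r))"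
    have B: "B > 0" by (simp add: B_def add_pos_nonneg sum_nonneg)
    \<comment> \<open>In each flight the coordinate of \<open>p (Suc i)\<close> falls from at least
      \<open>\<eta>\<close> to 0, so flight lengths are bounded below and the total time
      diverges.\<close>
    have step: "\<eta> / B \<le> dist (snd (w i)) (snd (w (Suc i)))" for i
    proof -
      let ?q = "p (Suc i)"
      have "\<eta> \<le> bary V ?q (l i) - bary V ?q (l (Suc i))"
        using lower[OF pV p_neq, of i] zero[of "Suc i"] by simp
      also have "\<dots> \<le> norm (bary_dir V ?q) * dist (l i) (l (Suc i))"
        using bary_diff_le[of ?q "l i" "l (Suc i)"] by simp
      also have "\<dots> \<le> B * dist (l i) (l (Suc i))"
        using member_le_sum[of ?q V "\<lambda>r. norm (bary_dir V r)"] finite_V pV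
        by (intro mult_right_mono) (auto simp: B_def)
      finally show ?thesis using B by (simp add: w_def field_simps)
    qed
    have "real n * (\<eta> / B) \<le> collision_time w n" for n
      using sum_mono[of "{..<n}" "\<lambda>_. \<eta> / B", OF step] by (simp add: collision_time_def)
    moreover have "filterlim (\<lambda>n. real n * (\<eta> / B)) at_top sequentially"
      using B \<eta>(1) by (intro filterlim_at_top_mult_tendsto_pos[OF tendsto_const] filterlim_real_sequentially) auto
    ultimately have "filterlim (collision_time w) at_top sequentially"
      by (auto intro: filterlim_at_top_mono)
    then show ?thesis using w server_orbit_iff by (auto simp: server_trajectory_def)
  qed
  have "0 < bary V r (snd (w 0))" if "r \<in> V" "r \<noteq> p 0" for r
    using lower[OF that] \<eta>(1) by (simp add: w_def)
  then have "stable_orbit V v F w" by (rule stable_orbitI[OF w P cover])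
  then have "stable_periodic_trajectory V v F w"
    using traj w_per P by (auto simp: stable_periodic_trajectory_def)
  moreover have "dist (z n) (w n) \<le> C * D * \<rho> ^ n" for n
  proof -
    have "synchronized z p w" using w by (simp add: synchronized_def w_def)
    moreover have "dist (z n) (w n) = dist (snd (z n)) (snd (w n))"
      by (rule dist_state_eq) (simp add: w_def)
    ultimately show ?thesis using sync_dist[OF synchronized_refl[OF z], of w n] by simp
  qed
  ultimately show ?thesis
    using that[of w \<rho> "C * D"] w_per C(1,2,3) D(1) by simp
qed

text \<open>The finitely many symbols repeat and evolve autonomously, so they are eventually
  periodic; the limit found for the tail is then compared with the whole orbit.\<close>

lemma trajectory_converges:
  assumes traj: "server_trajectory V v F z"
  shows "\<exists>w. stable_periodic_trajectory V v F w \<and> converges_exponentially z w"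
proof -
  obtain p where z: "itinerary z p" using traj server_orbit_iff by (auto simp: server_trajectory_def)
  define s where "s = (\<lambda>n. (p n, fst (z n)))"
  have "range s \<subseteq> V \<times> {..<DIM('a)}"
    using itinerary_in[OF z] itinerary_less[OF z] by (auto simp: s_def)
  then have "finite (range s)" using finite_V finite_subset by blast
  then have "\<not> inj s" using finite_imageD infinite_UNIV_nat by blast
  then obtain i j where ij: "i < j" "s i = s j" by (metis injI nat_neq_iff)
  define P where "P = j - i"
  have P: "P > 0" using ij by (simp add: P_def)
  have "s (n + j) = s (n + i)" for n
    using itinerary_deterministic[OF itinerary_shift[OF z, of j] itinerary_shift[OF z, of i], of n] ij(2)
    by (simp add: s_def)
  then have s_per: "s (n + P) = s n" if "n \<ge> i" for n
    using that ij(1) by (metis (no_types, lifting) P_def add.commute add_diff_assoc le_add_diff_inverse2 less_imp_le)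
  \<comment> \<open>A multiple of the period past the preperiod, so that the tail from
    \<open>N\<close> is in phase with \<open>w\<close> counted from 0.\<close>
  define N where "N = i * P"
  have iN: "i \<le> N" using P by (simp add: N_def)
  have z': "itinerary (\<lambda>n. z (n + N)) (\<lambda>n. p (n + N))" by (rule itinerary_shift[OF z])
  have per: "p (n + P + N) = p (n + N)" "fst (z (n + P + N)) = fst (z (n + N))" for n
    using s_per[of "n + N"] iN by (auto simp: s_def ac_simps)
  have visits: "\<exists>n\<ge>M. p (n + N) = r" if r: "r \<in> V" for r M
  proof -
    obtain n where "n \<ge> M + N" "p n = r" using trajectory_visits[OF traj z r] by blast
    then show ?thesis by (intro exI[of _ "n - N"]) auto
  qed
  have cover: "V \<subseteq> (\<lambda>n. p (n + N)) ` {m<..m + P}" for m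
    by (rule periodic_window_cover[OF per(1) P visits])
  obtain w C \<rho> where w: "stable_periodic_trajectory V v F w" "\<And>n. w (n + P) = w n"
    and \<rho>: "0 < \<rho>" "\<rho> < 1" "0 < C" and conv: "\<And>n. dist (z (n + N)) (w n) \<le> C * \<rho> ^ n"
    using periodic_symbols_limit[OF z' P per cover] by metis
  \<comment> \<open>The first summand undoes the shift by \<open>N\<close>, the second covers the
    finitely many earlier states.\<close>
  define C' where "C' = C / \<rho> ^ N + (\<Sum>i<N. dist (z i) (w i) / \<rho> ^ i)"
  have S: "0 \<le> (\<Sum>i<N. dist (z i) (w i) / \<rho> ^ i)" using \<rho> by (intro sum_nonneg) simp
  have "dist (z n) (w n) \<le> C' * \<rho> ^ n" for n
  proof (cases "n < N")
    case True
    have "dist (z n) (w n) / \<rho> ^ n \<le> (\<Sum>i<N. dist (z i) (w i) / \<rho> ^ i)"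
      using True \<rho> by (intro member_le_sum) auto
    then have "dist (z n) (w n) / \<rho> ^ n \<le> C'" using \<rho> by (simp add: C'_def add_increasing)
    then show ?thesis using \<rho> by (simp add: field_simps)
  next
    case False
    have "dist (z n) (w n) = dist (z (n - N + N)) (w (n - N))"
      using False periodic_add_mult[of w P, OF w(2), of "n - N" i] by (simp add: N_def)
    also have "\<dots> \<le> C * \<rho> ^ (n - N)" by (rule conv)
    also have "\<dots> = C / \<rho> ^ N * \<rho> ^ n" using False \<rho> by (simp add: power_diff)
    also have "\<dots> \<le> C' * \<rho> ^ n" using S \<rho> by (intro mult_right_mono) (auto simp: C'_def)
    finally show ?thesis .
  qed
  then have "converges_exponentially z w" using \<rho> by (auto simp: converges_exponentially_def)
  then show ?thesis using w by blast
qed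

section \<open>Uniqueness and number of periodic orbits\<close>

lemma periodic_face_unique:
  assumes z: "itinerary z p" and m: "m > 0" and per: "\<And>n. z (n + m) = z n"
    and r: "r \<in> V" "snd (z n) \<in> face V r"
  shows "p (n + m) = r"
proof (rule ccontr)
  \<comment> \<open>The state recurs at the positive time \<open>n + m\<close>, after a flight,
    where the point lies on only one facet. This settles the case \<open>n = 0\<close>, where no
    flight precedes.\<close>
  obtain n' where n': "n + m = Suc n'" using m by (cases "n + m") auto
  assume "p (n + m) \<noteq> r"
  then have "0 < bary V r (snd (z (n + m)))" using itinerary_pos[OF z r(1), of n'] n' by simp
  then show False using r per by (simp add: mem_face_iff)
qed

text \<open>Started at the common facet and field number, the two orbits are synchronized. Their
  distance tends to 0 but recurs at common multiples of the periods, so it is 0.\<close>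

lemma periodic_orbit_unique:
  assumes traj: "server_trajectory V v F z" "server_trajectory V v F w"
    and per: "m > 0" "\<And>n. z (n + m) = z n" "m' > 0" "\<And>n. w (n + m') = w n"
    and r: "r \<in> V" "snd (z i) \<in> face V r" "snd (w j) \<in> face V r" and k: "fst (z i) = fst (w j)"
  shows "range z = range w"
proof -
  obtain p where z: "itinerary z p" using traj server_orbit_iff by (auto simp: server_trajectory_def)
  obtain p' where w: "itinerary w p'" using traj server_orbit_iff by (auto simp: server_trajectory_def)
  have p_per: "p (n + m) = p n" for n
    by (rule periodic_face_unique[OF z per(1,2) itinerary_in[OF z] itinerary_face[OF z]])
  have p'_per: "p' (n + m') = p' n" for n
    by (rule periodic_face_unique[OF w per(3,4) itinerary_in[OF w] itinerary_face[OF w]])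
  have "p i = r" "p' j = r"
    using periodic_face_unique[OF z per(1,2) r(1,2)] periodic_face_unique[OF w per(3,4) r(1,3)] p_per p'_per
    by auto
  define z' where "z' = (\<lambda>n. z (n + i))"
  define w' where "w' = (\<lambda>n. w (n + j))"
  define q where "q = (\<lambda>n. p (n + i))"
  have z': "itinerary z' q" unfolding z'_def q_def by (rule itinerary_shift[OF z])
  have w'0: "itinerary w' (\<lambda>n. p' (n + j))" unfolding w'_def by (rule itinerary_shift[OF w])
  have same: "p' (n + j) = q n \<and> fst (w' n) = fst (z' n)" for n
    using itinerary_deterministic[OF w'0 z', of n] \<open>p i = r\<close> \<open>p' j = r\<close> k
    by (simp add: q_def z'_def w'_def)
  then have sync: "synchronized z' q w'" using w'0 by (simp add: synchronized_def)
  have per': "z' (n + m) = z' n" "w' (n + m') = w' n" "q (n + m) = q n" for n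
    using per(2)[of "n + i"] per(4)[of "n + j"] p_per[of "n + i"] by (simp_all add: z'_def w'_def q_def ac_simps)
  have visits: "\<exists>n\<ge>M. q n = s" if s: "s \<in> V" for s M
  proof -
    obtain n where "n \<ge> M + i" "p n = s" using trajectory_visits[OF traj(1) z s] by blast
    then show ?thesis by (intro exI[of _ "n - i"]) (auto simp: q_def)
  qed
  have cover: "V \<subseteq> q ` {a<..a + m}" for a
    by (rule periodic_window_cover[OF per'(3) per(1) visits])
  obtain C \<rho> where C: "0 < \<rho>" "\<rho> < 1" "0 < C"
    "\<And>w w' n. synchronized z' q w \<Longrightarrow> synchronized z' q w' \<Longrightarrow>
       dist (snd (w n)) (snd (w' n)) \<le> C * \<rho> ^ n * dist (snd (w 0)) (snd (w' 0))"
    using synchronized_exponential[OF z' per(1) cover] by metis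
  have "z' n = w' n" for n
  proof -
    have "dist (snd (z' n)) (snd (w' n)) \<le> C * \<rho> ^ a * dist (snd (z' 0)) (snd (w' 0))" for a
    proof -
      \<comment> \<open>\<open>m * m'\<close> is a common period: both states recur while the bound
        shrinks with \<open>a\<close>.\<close>
      let ?N = "n + a * (m * m')"
      have "z' ?N = z' n" "w' ?N = w' n"
        using periodic_add_mult[of z' m, OF per'(1), of n "a * m'"] periodic_add_mult[of w' m', OF per'(2), of n "a * m"]
        by (simp_all add: ac_simps)
      then have "dist (snd (z' n)) (snd (w' n)) \<le> C * \<rho> ^ ?N * dist (snd (z' 0)) (snd (w' 0))"
        using C(4)[OF synchronized_refl[OF z'] sync, of ?N] by simp
      also have "\<dots> \<le> C * \<rho> ^ a * dist (snd (z' 0)) (snd (w' 0))"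
        using C per(1,3) by (intro mult_right_mono mult_left_mono power_decreasing) (auto intro: trans_le_add2)
      finally show ?thesis .
    qed
    moreover have "(\<lambda>a. C * \<rho> ^ a * dist (snd (z' 0)) (snd (w' 0))) \<longlonglongrightarrow> C * 0 * dist (snd (z' 0)) (snd (w' 0))"
      using C by (intro tendsto_intros LIMSEQ_realpow_zero) auto
    ultimately have "dist (snd (z' n)) (snd (w' n)) \<le> C * 0 * dist (snd (z' 0)) (snd (w' 0))"
      by (intro tendsto_lowerbound[where F = sequentially]) auto
    then show ?thesis using same[of n] by (simp add: prod_eq_iff)
  qed
  then have "range z' = range w'" by simp
  then show ?thesis
    using range_shift_periodic[of z m i, OF per(2,1)] range_shift_periodic[of w m' j, OF per(4,3)]
    by (simp add: z'_def w'_def)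
qed

text \<open>
  A stable periodic orbit meets every facet, and the field numbers it uses on a fixed facet determine
  it.
\<close>

lemma stable_periodic_orbits_card:
  "finite (stable_periodic_orbits V v F) \<and> card (stable_periodic_orbits V v F) \<le> DIM('a)"
proof -
  let ?S = "stable_periodic_orbits V v F"
  obtain r where r: "r \<in> V" using card_V by fastforce
  \<comment> \<open>An orbit may use several numbers on the facet of \<open>r\<close>; by
    \<open>periodic_orbit_unique\<close> any one of them identifies it.\<close>
  define g where "g = (\<lambda>T :: (nat \<times> 'a) set. SOME k. \<exists>x. (k, x) \<in> T \<and> x \<in> face V r)"
  have g: "\<exists>z m i. server_trajectory V v F z \<and> m > 0 \<and> (\<forall>n. z (n + m) = z n) \<and> T = range z \<and>
      snd (z i) \<in> face V r \<and> fst (z i) = g T \<and> g T < DIM('a)" if T: "T \<in> ?S" for T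
  proof -
    obtain z m where z: "T = range z" "server_trajectory V v F z" "m > 0" "\<forall>n. z (n + m) = z n"
      using T unfolding stable_periodic_orbits_def stable_periodic_trajectory_def by blast
    obtain p where p: "itinerary z p" using z(2) server_orbit_iff by (auto simp: server_trajectory_def)
    obtain n where "p n = r" using trajectory_visits[OF z(2) p r] by blast
    then have "(fst (z n), snd (z n)) \<in> T \<and> snd (z n) \<in> face V r"
      using itinerary_face[OF p, of n] z(1) by simp
    then have "\<exists>k x. (k, x) \<in> T \<and> x \<in> face V r" by blast
    then have "\<exists>x. (g T, x) \<in> T \<and> x \<in> face V r" unfolding g_def by (rule someI_ex)
    then obtain i where "snd (z i) \<in> face V r" "fst (z i) = g T"
      unfolding z(1) by (metis fst_conv snd_conv imageE)
    then show ?thesis using z itinerary_less[OF p, of i] by metis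
  qed
  have "inj_on g ?S"
  proof (rule inj_onI)
    fix T T' assume O: "T \<in> ?S" "T' \<in> ?S" "g T = g T'"
    show "T = T'" using g[OF O(1)] g[OF O(2)] O(3) periodic_orbit_unique[OF _ _ _ _ _ _ r] by metis
  qed
  moreover have "g ` ?S \<subseteq> {..<DIM('a)}" using g by blast
  ultimately show ?thesis
    using inj_on_finite card_inj_on_le by (metis card_lessThan finite_lessThan)
qed

end

theorem theorem2p11:
  fixes V :: "'a::euclidean_space set"
    and v opp :: "'a \<Rightarrow> nat \<Rightarrow> 'a"
    and F :: "nat \<Rightarrow> nat"
  assumes "equilateral_unit_pyramid V"
    and "server_fields V v"
    and "F ` {..<DIM('a)} \<subseteq> {..<DIM('a)}"
    and "field_correspondence V opp"
    and "standing_assumption V v opp"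
  shows "(\<forall>z. server_trajectory V v F z \<longrightarrow>
            (\<exists>w. stable_periodic_trajectory V v F w \<and> converges_exponentially z w)) \<and>
         finite (stable_periodic_orbits V v F) \<and>
         card (stable_periodic_orbits V v F) \<le> (DIM('a) + 1) ^ DIM('a)"
proof -
  interpret switched_server V v opp F
    using assms by unfold_locales
  \<comment> \<open>Counting by field numbers on one facet gives at most \<open>DIM('a)\<close>
    orbits; the stated bound follows as the dimension is at least 1.\<close>
  have "DIM('a) \<le> DIM('a) + 1" by simp
  also have "\<dots> = (DIM('a) + 1) ^ 1" by simp
  also have "\<dots> \<le> (DIM('a) + 1) ^ DIM('a)"
    by (intro power_increasing) (simp_all add: Suc_leI)
  finally show ?thesis
    using trajectory_converges stable_periodic_orbits_card by (meson order_trans)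
qed

end
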